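(* In the setting described in the context (problem $\min F=f+r$, stochastic models satisfying (C1)–(C5), positive nonincreasing step-sizes $\{\eta_t\}_{t\ge0}$), for all integers $T>0$ the iterates of the stochastic model-based algorithm satisfy $$\mathbb{E}\left[F\left(\frac{1}{\sum_{t=0}^T \eta_t }\sum_{t=0}^T\eta_t x_t\right) - F(x^\ast)\right] \leq \frac{D_\Phi(x^\ast, x_0) + \sum_{t=0}^T \frac{(\eta_t \mathsf{L})^2}{4} + \eta_0(r(x_0) - \inf r) }{\sum_{t=0}^T \eta_t},$$ where $x^*$ is any minimizer of $F$.
   Context: Legendre functions. $\Phi\colon\mathbb{R}^d\to\mathbb{R}\cup\{\infty\}$ is a Legendre function: it is proper, closed, strictly convex; $U:=\mathrm{int}(\mathrm{dom}\,\Phi)$ is nonempty; $\Phi$ is differentiable on $U$; and $\|\nabla\Phi(x_k)\|\to\infty$ for any sequence $\{x_k\}\subset U$ converging to a boundary point of $\mathrm{dom}\,\Phi$. Its Bregman divergence is $D_\Phi(y,x)=\Phi(y)-\Phi(x)-\langle\nabla\Phi(x),y-x\rangle$ for $x\in U$ (equal to $+\infty$ if $y\notin\mathrm{dom}\,\Phi$). A function $g$ is $\mu$-strongly convex relative to $\Phi$ if $g-\mu\Phi$ is convex (for functions defined only on $U$: convex on $U$); $\mu=0$ is plain convexity. Problem. $\min_x F(x):=f(x)+r(x)$, where $f\colon\mathbb{R}^d\to\mathbb{R}$ is locally Lipschitz, $r\colon\mathbb{R}^d\to\mathbb{R}\cup\{\infty\}$ is closed with convex domain, and $\mathrm{ri}(\mathrm{dom}\,r)\subseteq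 U$ and $\partial(r+\Phi)(x)=\emptyset$ for all $x\notin U$. Here $\partial$ is the limiting subdifferential: $v\in\partial g(x)$ iff there are $x_k\to x$ with $g(x_k)\to g(x)$ and $v_k\to v$ with $v_k\in\hat\partial g(x_k)$, where $\hat\partial g(x)=\{v: g(y)\ge g(x)+\langle v,y-x\rangle+o(\|y-x\|)\text{ as }y\to x\}$. Assumptions. $(\Omega,\mathcal{F},P)$ is a probability space and: (C1) i.i.d. samples $\xi_0,\xi_1,\ldots\sim P$ can be generated. (C2) There is a measurable function $(x,y,\xi)\mapsto f_x(y,\xi)$ on $U\times U\times\Omega$ with $\mathbb{E}_\xi[f_x(x,\xi)]=f(x)$ for all $x\in U\cap\mathrm{dom}\,r$ and $\mathbb{E}_\xi[f_x(y,\xi)]\le f(y)$ for all $x,y\in U\cap\mathrm{dom}\,r$. (C3) There is $\mu\ge0$ such that $f_x(\cdot,\xi)+r(\cdot)$ is $\mu$-strongly convex relative to $\Phi$ for all $x\in U\cap\mathrm{dom}\,r$ and a.e. $\xi\in\Omega$. (C4) There are $\mathsf{L}>0$ and a square integrable $L\colon\Omega\to\mathbb{R}_+$ with $\sqrt{\mathbb{E}_\xi[L(\xi)^2]}\le\mathsf{L}$ and $f_x(x,\xi)-f_x(y,\xi)\le L(\xi)\sqrt{D_\Phi(y,x)}$ for all $x,y\in U\cap\mathrm{dom}\,r$. (C5) For every $\lambda>0$, $x\in U$ and a.e. $\xi$, the problems $\min_y\{F(y)+\frac1\lambda D_\Phi(y,x)\}$ and $\min_y\{f_x(y,\xi)+r(y)+\frac1\lambda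 D_\Phi(y,x)\}$ admit minimizers (unique and lying in $U$), varying measurably in $(x,\xi)\in U\times\Omega$. Minimization involving the models is over $y\in U$. Algorithm. Given $x_0\in U\cap\mathrm{dom}\,r$ and a nonincreasing sequence of step-sizes $\eta_t>0$: for $t=0,1,2,\ldots$, sample $\xi_t\sim P$ (independently) and set $x_{t+1}=\mathrm{argmin}_x\{f_{x_t}(x,\xi_t)+r(x)+\frac{1}{\eta_t}D_\Phi(x,x_t)\}$. *)

theory Defs
  imports "HOL-Probability.Probability" "HOL-Library.Landau_Symbols"
begin

text \<open>
  Functions with values in \<open>\<real> \<union> {\<infinity>}\<close> are represented by functions into \<^typ>\<open>ereal\<close> that never take
  the value \<open>-\<infinity>\<close>; this is a conjunct of \<open>legendre\<close> below and has to be assumed separately elsewhere.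
\<close>

definition edom :: "('a \<Rightarrow> ereal) \<Rightarrow> 'a set" where
  "edom g = {x. g x < \<infinity>}"

definition closed_fun :: "('a::topological_space \<Rightarrow> ereal) \<Rightarrow> bool" where
  "closed_fun g \<longleftrightarrow> closed {(x, a::real). g x \<le> ereal a}"

text \<open>
  The right-hand side is the usual one for extended-valued functions because \<open>0 * \<infinity> = 0\<close> in
  \<^typ>\<open>ereal\<close>; no sum \<open>\<infinity> - \<infinity>\<close> occurs as long as \<open>g\<close> avoids \<open>-\<infinity>\<close> on \<open>S\<close>.
\<close>
definition econvex_on :: "'a::real_vector set \<Rightarrow> ('a \<Rightarrow> ereal) \<Rightarrow> bool" where
  "econvex_on S g \<longleftrightarrow> convex S \<and>
    (\<forall>x\<in>S. \<forall>y\<in>S. \<forall>u\<ge>0. \<forall>v\<ge>0. u + v = 1 \<longrightarrow>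
      g (u *\<^sub>R x + v *\<^sub>R y) \<le> ereal u * g x + ereal v * g y)"

definition strictly_econvex :: "('a::real_vector \<Rightarrow> ereal) \<Rightarrow> bool" where
  "strictly_econvex g \<longleftrightarrow>
    (\<forall>x\<in>edom g. \<forall>y\<in>edom g. \<forall>u>0. \<forall>v>0. x \<noteq> y \<longrightarrow> u + v = 1 \<longrightarrow>
      g (u *\<^sub>R x + v *\<^sub>R y) < ereal u * g x + ereal v * g y)"

text \<open>
  Relative strong convexity of \<open>g\<close> with respect to \<open>\<Phi>\<close> on a set \<open>U\<close> where \<open>\<Phi>\<close> is finite.
\<close>
definition rel_strongly_convex_on ::
    "'a::real_vector set \<Rightarrow> real \<Rightarrow> ('a \<Rightarrow> ereal) \<Rightarrow> ('a \<Rightarrow> ereal) \<Rightarrow> bool" where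
  "rel_strongly_convex_on U \<mu> \<Phi> g \<longleftrightarrow> econvex_on U (\<lambda>y. g y - ereal \<mu> * \<Phi> y)"

definition gradient :: "('a::real_inner \<Rightarrow> real) \<Rightarrow> 'a \<Rightarrow> 'a" where
  "gradient g x = (THE v. GDERIV g x :> v)"

text \<open>
  The real-valued part of an extended-valued function is only differentiated at interior points of
  its effective domain.
\<close>
abbreviation egradient :: "('a::real_inner \<Rightarrow> ereal) \<Rightarrow> 'a \<Rightarrow> 'a" where
  "egradient g \<equiv> gradient (\<lambda>z. real_of_ereal (g z))"

definition legendre :: "('a::euclidean_space \<Rightarrow> ereal) \<Rightarrow> bool" where
  "legendre \<Phi> \<longleftrightarrow>
    (\<forall>x. \<Phi> x \<noteq> -\<infinity>) \<and> edom \<Phi> \<noteq> {} \<and> closed_fun \<Phi> \<and> strictly_econvex \<Phi> \<and>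
    interior (edom \<Phi>) \<noteq> {} \<and>
    (\<forall>x\<in>interior (edom \<Phi>). (\<lambda>z. real_of_ereal (\<Phi> z)) differentiable (at x)) \<and>
    (\<forall>s x. range s \<subseteq> interior (edom \<Phi>) \<and> x \<in> frontier (edom \<Phi>) \<and> s \<longlonglongrightarrow> x \<longrightarrow>
      filterlim (\<lambda>k. norm (egradient \<Phi> (s k))) at_top sequentially)"

text \<open>
  Only meaningful for \<open>x \<in> interior (edom \<Phi>)\<close>. It equals \<open>\<infinity>\<close> for \<open>y\<close> outside \<open>edom \<Phi>\<close>.
\<close>
definition bregman :: "('a::euclidean_space \<Rightarrow> ereal) \<Rightarrow> 'a \<Rightarrow> 'a \<Rightarrow> ereal" where
  "bregman \<Phi> y x = \<Phi> y - \<Phi> x - ereal (egradient \<Phi> x \<bullet> (y - x))"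

text \<open>
  As usual, both subdifferentials are empty at points where \<open>g\<close> is not finite.
\<close>
definition frechet_subdiff :: "('a::euclidean_space \<Rightarrow> ereal) \<Rightarrow> 'a \<Rightarrow> 'a set" where
  "frechet_subdiff g x = {v. \<bar>g x\<bar> \<noteq> \<infinity> \<and>
    (\<exists>\<rho>\<in>o[at x](\<lambda>y. norm (y - x)).
      \<forall>\<^sub>F y in at x. g x + ereal (v \<bullet> (y - x)) + ereal (\<rho> y) \<le> g y)}"

definition limiting_subdiff :: "('a::euclidean_space \<Rightarrow> ereal) \<Rightarrow> 'a \<Rightarrow> 'a set" where
  "limiting_subdiff g x = {v. \<bar>g x\<bar> \<noteq> \<infinity> \<and>
    (\<exists>s w. s \<longlonglongrightarrow> x \<and> (\<lambda>k. g (s k)) \<longlonglongrightarrow> g x \<and> w \<longlonglongrightarrow> v \<and>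
      (\<forall>k. w k \<in> frechet_subdiff g (s k)))}"

definition locally_lipschitz :: "('a::metric_space \<Rightarrow> real) \<Rightarrow> bool" where
  "locally_lipschitz f \<longleftrightarrow> (\<forall>x. \<exists>e>0. \<exists>C. C-lipschitz_on (ball x e) f)"

definition unique_minimizer :: "'a set \<Rightarrow> ('a \<Rightarrow> ereal) \<Rightarrow> 'a \<Rightarrow> bool" where
  "unique_minimizer A g y \<longleftrightarrow>
    is_arg_min g (\<lambda>z. z \<in> A) y \<and> (\<forall>z. is_arg_min g (\<lambda>z. z \<in> A) z \<longrightarrow> z = y)"

text \<open>
  \<open>p\<close> is the measurable map that sends \<open>x\<close> to the minimizer of \<open>F + D\<^sub>\<Phi>(\<cdot>, x) / l\<close> over the whole space.
\<close>
definition prox_map ::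
    "('a::euclidean_space \<Rightarrow> ereal) \<Rightarrow> ('a \<Rightarrow> ereal) \<Rightarrow> real \<Rightarrow> ('a \<Rightarrow> 'a) \<Rightarrow> bool" where
  "prox_map \<Phi> F l p \<longleftrightarrow>
    p \<in> restrict_space borel (interior (edom \<Phi>)) \<rightarrow>\<^sub>M restrict_space borel (interior (edom \<Phi>)) \<and>
    (\<forall>x\<in>interior (edom \<Phi>).
      unique_minimizer UNIV (\<lambda>y. F y + ereal (1 / l) * bregman \<Phi> y x) (p x))"

text \<open>
  \<open>q x \<xi>\<close> is the minimizer over \<open>U = interior (edom \<Phi>)\<close> of the stochastic model at \<open>x\<close>, which is
  written \<open>fm x y \<xi>\<close> for the value at \<open>y\<close> of the model centred at \<open>x\<close> for the sample \<open>\<xi>\<close>.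
  For each \<open>x\<close> there is an exceptional null set of samples; there, \<open>q\<close> is an arbitrary
  point of \<open>U\<close>, subject to joint measurability.
\<close>
definition model_prox_map ::
    "'o measure \<Rightarrow> ('a::euclidean_space \<Rightarrow> ereal) \<Rightarrow> ('a \<Rightarrow> ereal) \<Rightarrow> ('a \<Rightarrow> 'a \<Rightarrow> 'o \<Rightarrow> real) \<Rightarrow>
      real \<Rightarrow> ('a \<Rightarrow> 'o \<Rightarrow> 'a) \<Rightarrow> bool" where
  "model_prox_map P \<Phi> r fm l q \<longleftrightarrow>
    (\<lambda>(x, \<xi>). q x \<xi>) \<in> restrict_space borel (interior (edom \<Phi>)) \<Otimes>\<^sub>M P
      \<rightarrow>\<^sub>M restrict_space borel (interior (edom \<Phi>)) \<and>
    (\<forall>x\<in>interior (edom \<Phi>). AE \<xi> in P.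
      unique_minimizer (interior (edom \<Phi>))
        (\<lambda>y. ereal (fm x y \<xi>) + r y + ereal (1 / l) * bregman \<Phi> y x) (q x \<xi>))"

end

theory Submission imports Defs begin

text \<open>
  Put \<open>V = U \<inter> edom r\<close> and let \<open>y \<in> V\<close>. On \<open>V\<close> everything is finite, and the model
  \<open>f\<^sub>x(\<cdot>, s) + r\<close> is convex there for almost every sample \<open>s\<close>. The minimizer \<open>q\<close> of the model plus
  \<open>D(\<cdot>, x) / \<eta>\<close> therefore satisfies the three-point inequality (\<open>bregman_three_points\<close>); together
  with the one-sided Lipschitz bound, and after completing a square in \<open>sqrt (D(q, x))\<close>, this gives
  \<open>\<eta> r(q) + D(y, q) + \<eta> f\<^sub>x(x, s) \<le> \<eta> r(y) + \<eta> f\<^sub>x(y, s) + D(y, x) + (\<eta> L(s))\<^sup>2 / 4\<close>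
  (\<open>model_prox_step\<close>). Integrating over \<open>s\<close> alone turns the model values into \<open>f(x)\<close> and at most
  \<open>f(y)\<close>. With a lower bound \<open>R\<close> of \<open>r\<close>, the function \<open>W\<^sub>t(x) = \<eta>\<^sub>t (r(x) - R) + D(y, x)\<close> is then
  nonnegative and decreases in conditional expectation along the algorithm by at least
  \<open>\<eta>\<^sub>t (F(x) - F(y)) - (\<eta>\<^sub>t Lc)\<^sup>2 / 4\<close>; it also decreases in \<open>t\<close> because the step sizes do. Telescoping
  (\<open>sum_expectation_le_lyapunov\<close>) bounds \<open>\<Sum>t. \<eta>\<^sub>t E[F(X\<^sub>t) - F(y)]\<close>; the initial value
  \<open>W\<^sub>0(x\<^sub>0)\<close> supplies the terms \<open>D(y, x\<^sub>0)\<close> and \<open>\<eta>\<^sub>0 (r(x\<^sub>0) - R)\<close> of the bound, with \<open>R = inf r\<close>.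

  The average of the iterates is handled by Jensen's inequality. Neither \<open>f\<close> nor \<open>r\<close> is assumed
  convex, but \<open>F\<close> is convex on \<open>V\<close>: by averaging over \<open>s\<close>, the models give for every \<open>z \<in> V\<close> a convex
  minorant of \<open>F\<close> on \<open>V\<close> that agrees with \<open>F\<close> at \<open>z\<close> (\<open>convex_on_objective\<close>).

  The minimizer \<open>xstar\<close> may lie on the boundary of \<open>U\<close>, where the models give no information, so
  \<open>y = xstar\<close> is not allowed above. The deterministic proximal points \<open>p\<^sub>l(x\<^sub>0)\<close>, which lie in \<open>U\<close>, take
  its place: comparing the proximal objective at \<open>p\<^sub>l(x\<^sub>0)\<close> and at \<open>xstar\<close> shows both
  \<open>F(p\<^sub>l(x\<^sub>0)) \<le> F(xstar) + D(xstar, x\<^sub>0) / l\<close> and \<open>D(p\<^sub>l(x\<^sub>0), x\<^sub>0) \<le> D(xstar, x\<^sub>0)\<close>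
  (\<open>prox_point_estimate\<close>). Letting \<open>l \<rightarrow> \<infinity>\<close> yields the claim, which is trivial if
  \<open>D(xstar, x\<^sub>0)\<close> or \<open>- inf r\<close> is infinite.

  All expectations are integrals of \<^typ>\<open>ennreal\<close>-valued functions. The value \<open>\<infinity>\<close> then records
  infeasible iterates, and no integrability of \<open>r(X\<^sub>t)\<close> or \<open>D(y, X\<^sub>t)\<close> has to be established. Since
  one step is integrated over \<open>s\<close> for each fixed \<open>x\<close>, the exceptional null sets of samples may depend
  on \<open>x\<close> in an arbitrary, even nonmeasurable, way.
\<close>

section \<open>Gradients and Bregman divergences of Legendre functions\<close>

lemma GDERIV_gradient:
  fixes g :: "'a::euclidean_space \<Rightarrow> real"
  assumes "g differentiable (at x)"
  shows "GDERIV g x :> gradient g x"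
proof -
  obtain g' where g': "(g has_derivative g') (at x)"
    using assms by (auto simp: differentiable_def)
  have "linear g'"
    using g' by (rule has_derivative_linear)
  then have "g' = (\<lambda>h. h \<bullet> adjoint g' 1)"
    using adjoint_works[of g' _ 1] by auto
  then have ex: "GDERIV g x :> adjoint g' 1"
    using g' unfolding gderiv_def by metis
  have uniq: "v = adjoint g' 1" if "GDERIV g x :> v" for v
  proof -
    have "(\<lambda>h. h \<bullet> v) = (\<lambda>h. h \<bullet> adjoint g' 1)"
      using that ex unfolding gderiv_def by (rule has_derivative_unique)
    then have "h \<bullet> v = h \<bullet> adjoint g' 1" for h by (rule fun_cong)
    then show ?thesis using vector_eq_ldot[of v "adjoint g' 1"] by simp
  qed
  show ?thesis
    unfolding gradient_def using ex uniq by (rule theI)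
qed

lemma directional_derivative_tendsto:
  fixes g :: "'a::euclidean_space \<Rightarrow> real"
  assumes "g differentiable (at x)"
  shows "((\<lambda>t. (g (x + t *\<^sub>R d) - g x) / t) \<longlongrightarrow> gradient g x \<bullet> d) (at_right 0)"
proof -
  have "(g has_derivative (\<lambda>h. h \<bullet> gradient g x)) (at (x + 0 *\<^sub>R d))"
    using GDERIV_gradient[OF assms] by (simp add: gderiv_def)
  moreover have "((\<lambda>t::real. x + t *\<^sub>R d) has_derivative (\<lambda>t. t *\<^sub>R d)) (at 0)"
    by (auto intro!: derivative_eq_intros)
  ultimately have "((\<lambda>t. g (x + t *\<^sub>R d)) has_derivative (\<lambda>t. (t *\<^sub>R d) \<bullet> gradient g x)) (at 0)"
    by (rule has_derivative_compose[where f = "\<lambda>t. x + t *\<^sub>R d" and x = 0, rotated])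
  then have "((\<lambda>t. g (x + t *\<^sub>R d)) has_field_derivative gradient g x \<bullet> d) (at 0)"
    unfolding has_field_derivative_def
    by (rule has_derivative_eq_rhs) (auto simp: inner_commute)
  then have "((\<lambda>t. (g (x + t *\<^sub>R d) - g x) / t) \<longlongrightarrow> gradient g x \<bullet> d) (at 0)"
    by (simp add: has_field_derivative_iff)
  then show ?thesis
    by (rule tendsto_mono[rotated]) (simp add: at_le)
qed

lemma legendre_interior_real:
  assumes "legendre \<Phi>" "x \<in> interior (edom \<Phi>)"
  shows "\<Phi> x = ereal (real_of_ereal (\<Phi> x))"
proof -
  have "\<Phi> x \<noteq> \<infinity>"
    using assms(2) interior_subset[of "edom \<Phi>"] by (auto simp: edom_def)
  moreover have "\<Phi> x \<noteq> -\<infinity>"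
    using assms(1) unfolding legendre_def by blast
  ultimately show ?thesis
    by (cases "\<Phi> x") simp_all
qed

lemma legendre_edom_convex:
  fixes \<Phi> :: "'a::euclidean_space \<Rightarrow> ereal"
  assumes leg: "legendre \<Phi>" shows "convex (edom \<Phi>)"
proof (rule convexI)
  fix x y and u v :: real
  assume a: "x \<in> edom \<Phi>" "y \<in> edom \<Phi>" "0 \<le> u" "0 \<le> v" "u + v = 1"
  consider "x = y" | "u = 0" | "v = 0" | "x \<noteq> y" "u > 0" "v > 0"
    using a(3,4) by linarith
  then show "u *\<^sub>R x + v *\<^sub>R y \<in> edom \<Phi>"
  proof cases
    case 1
    then have "u *\<^sub>R x + v *\<^sub>R y = x" using a(5) by (metis scaleR_add_left scaleR_one)
    then show ?thesis using a(1) by simp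
  next
    case 4
    then have "\<Phi> (u *\<^sub>R x + v *\<^sub>R y) < ereal u * \<Phi> x + ereal v * \<Phi> y"
      using leg a(1,2,5) unfolding legendre_def strictly_econvex_def by blast
    then show ?thesis unfolding edom_def by (auto intro: less_le_trans)
  qed (use a in simp_all)
qed

lemma legendre_convex_on:
  fixes \<Phi> :: "'a::euclidean_space \<Rightarrow> ereal"
  assumes leg: "legendre \<Phi>"
  shows "convex_on (interior (edom \<Phi>)) (\<lambda>z. real_of_ereal (\<Phi> z))"
proof (rule convex_onI)
  show cU: "convex (interior (edom \<Phi>))"
    using legendre_edom_convex[OF leg] by (rule convex_interior)
  fix t :: real and x y
  assume a: "0 < t" "t < 1" "x \<in> interior (edom \<Phi>)" "y \<in> interior (edom \<Phi>)"
  let ?z = "(1 - t) *\<^sub>R x + t *\<^sub>R y"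
  have z: "?z \<in> interior (edom \<Phi>)"
    using cU a by (intro convexD) auto
  show "real_of_ereal (\<Phi> ?z) \<le> (1 - t) * real_of_ereal (\<Phi> x) + t * real_of_ereal (\<Phi> y)"
  proof (cases "x = y")
    case True
    then show ?thesis by (simp add: algebra_simps)
  next
    case False
    obtain a b c where abc: "\<Phi> x = ereal a" "\<Phi> y = ereal b" "\<Phi> ?z = ereal c"
      using legendre_interior_real[OF leg] a z by metis
    have "x \<in> edom \<Phi>" "y \<in> edom \<Phi>" using a interior_subset by blast+
    moreover have "0 < 1 - t" "1 - t + t = 1" using a by auto
    ultimately have "\<Phi> ?z < ereal (1 - t) * \<Phi> x + ereal t * \<Phi> y"
      using leg a(1) False unfolding legendre_def strictly_econvex_def by blast
    then show ?thesis unfolding abc by simp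
  qed
qed

lemma bregman_interior:
  assumes "legendre \<Phi>" "x \<in> interior (edom \<Phi>)" "y \<in> interior (edom \<Phi>)"
  shows "bregman \<Phi> y x = ereal (real_of_ereal (\<Phi> y) - real_of_ereal (\<Phi> x) - egradient \<Phi> x \<bullet> (y - x))"
proof -
  obtain a b where "\<Phi> x = ereal a" "\<Phi> y = ereal b"
    using legendre_interior_real assms by metis
  then show ?thesis by (simp add: bregman_def)
qed

lemma legendre_differentiable:
  assumes "legendre \<Phi>" "x \<in> interior (edom \<Phi>)"
  shows "(\<lambda>z. real_of_ereal (\<Phi> z)) differentiable (at x)"
proof -
  have "\<forall>x\<in>interior (edom \<Phi>). (\<lambda>z. real_of_ereal (\<Phi> z)) differentiable (at x)"
    using assms(1) unfolding legendre_def by (elim conjE)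
  then show ?thesis using assms(2) by (rule bspec)
qed

text \<open>
  Minimality of \<open>q\<close> is tested only along the segment from \<open>q\<close> to \<open>y\<close>, which stays in \<open>V\<close>. Dividing by
  the step length and letting it tend to \<open>0\<close> gives a first-order condition at \<open>q\<close> in the direction
  \<open>y - q\<close>, although \<open>h\<close> need not be differentiable; the three divergences enter because
  \<open>(\<nabla>\<Phi> q - \<nabla>\<Phi> x) \<bullet> (y - q) = D(y, x) - D(q, x) - D(y, q)\<close>.
\<close>
lemma bregman_three_points:
  fixes \<Phi> :: "'a::euclidean_space \<Rightarrow> ereal"
  assumes leg: "legendre \<Phi>" and VU: "V \<subseteq> interior (edom \<Phi>)" and h: "convex_on V h"
    and x: "x \<in> interior (edom \<Phi>)" and q: "q \<in> V" and y: "y \<in> V" and c: "c \<ge> 0"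
    and min: "\<And>z. z \<in> V \<Longrightarrow> h q + c * real_of_ereal (bregman \<Phi> q x)
                             \<le> h z + c * real_of_ereal (bregman \<Phi> z x)"
  shows "h q + c * real_of_ereal (bregman \<Phi> q x) + c * real_of_ereal (bregman \<Phi> y q)
       \<le> h y + c * real_of_ereal (bregman \<Phi> y x)"
proof -
  let ?\<phi> = "\<lambda>z. real_of_ereal (\<Phi> z)"
  have qU: "q \<in> interior (edom \<Phi>)" and yU: "y \<in> interior (edom \<Phi>)" using VU q y by auto
  have "((\<lambda>t. c * ((?\<phi> (q + t *\<^sub>R (y - q)) - ?\<phi> q) / t - egradient \<Phi> x \<bullet> (y - q)))
      \<longlongrightarrow> c * (egradient \<Phi> q \<bullet> (y - q) - egradient \<Phi> x \<bullet> (y - q))) (at_right 0)"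
    by (intro tendsto_intros directional_derivative_tendsto legendre_differentiable leg qU)
  moreover have "\<forall>\<^sub>F t in at_right 0. h q - h y
      \<le> c * ((?\<phi> (q + t *\<^sub>R (y - q)) - ?\<phi> q) / t - egradient \<Phi> x \<bullet> (y - q))"
    unfolding eventually_at_right_field
  proof (intro exI[of _ "1::real"] conjI allI impI)
    fix t :: real assume t: "0 < t" "t < 1"
    let ?z = "q + t *\<^sub>R (y - q)"
    have ze: "?z = (1 - t) *\<^sub>R q + t *\<^sub>R y" by (simp add: algebra_simps)
    have z: "?z \<in> V" unfolding ze
      using convex_on_imp_convex[OF h] q y t by (intro convexD) auto
    then have zU: "?z \<in> interior (edom \<Phi>)" using VU by auto
    have "h ?z \<le> (1 - t) * h q + t * h y"
      unfolding ze using convex_onD[OF h, of t q y] t q y by simp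
    with min[OF z] have "t * (h q - h y) \<le> c * (real_of_ereal (bregman \<Phi> ?z x) - real_of_ereal (bregman \<Phi> q x))"
      by (simp add: algebra_simps)
    also have "real_of_ereal (bregman \<Phi> ?z x) - real_of_ereal (bregman \<Phi> q x)
        = (?\<phi> ?z - ?\<phi> q) - t * (egradient \<Phi> x \<bullet> (y - q))"
      by (simp add: bregman_interior leg x zU qU inner_diff_right inner_add_right)
    also have "\<dots> = t * ((?\<phi> ?z - ?\<phi> q) / t - egradient \<Phi> x \<bullet> (y - q))"
      using t by (simp add: field_simps)
    finally have "t * (h q - h y) \<le> t * (c * ((?\<phi> ?z - ?\<phi> q) / t - egradient \<Phi> x \<bullet> (y - q)))"
      by (simp add: mult.left_commute)
    then show "h q - h y \<le> c * ((?\<phi> ?z - ?\<phi> q) / t - egradient \<Phi> x \<bullet> (y - q))"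
      using t by simp
  qed simp
  ultimately have "h q - h y \<le> c * (egradient \<Phi> q \<bullet> (y - q) - egradient \<Phi> x \<bullet> (y - q))"
    by (rule tendsto_lowerbound) simp
  also have "egradient \<Phi> q \<bullet> (y - q) - egradient \<Phi> x \<bullet> (y - q)
     = real_of_ereal (bregman \<Phi> y x) - real_of_ereal (bregman \<Phi> q x) - real_of_ereal (bregman \<Phi> y q)"
    by (simp add: bregman_interior leg x qU yU inner_diff_right)
  finally show ?thesis by (simp add: algebra_simps)
qed

lemma bregman_nonneg:
  fixes \<Phi> :: "'a::euclidean_space \<Rightarrow> ereal"
  assumes leg: "legendre \<Phi>" and x: "x \<in> interior (edom \<Phi>)" and y: "y \<in> interior (edom \<Phi>)"
  shows "0 \<le> bregman \<Phi> y x"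
proof -
  let ?\<phi> = "\<lambda>z. real_of_ereal (\<Phi> z)"
  have "\<forall>\<^sub>F t in at_right 0. (?\<phi> (x + t *\<^sub>R (y - x)) - ?\<phi> x) / t \<le> ?\<phi> y - ?\<phi> x"
    unfolding eventually_at_right_field
  proof (intro exI[of _ "1::real"] conjI allI impI)
    fix t :: real assume t: "0 < t" "t < 1"
    have ze: "x + t *\<^sub>R (y - x) = (1 - t) *\<^sub>R x + t *\<^sub>R y" by (simp add: algebra_simps)
    have "?\<phi> (x + t *\<^sub>R (y - x)) - ?\<phi> x \<le> (?\<phi> y - ?\<phi> x) * t"
      using convex_onD[OF legendre_convex_on[OF leg], of t x y] t x y
      unfolding ze by (simp add: algebra_simps)
    then show "(?\<phi> (x + t *\<^sub>R (y - x)) - ?\<phi> x) / t \<le> ?\<phi> y - ?\<phi> x"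
      using t by (simp add: pos_divide_le_eq)
  qed simp
  with directional_derivative_tendsto[OF legendre_differentiable[OF leg x]]
  have "egradient \<Phi> x \<bullet> (y - x) \<le> ?\<phi> y - ?\<phi> x"
    by (rule tendsto_upperbound) simp
  then show ?thesis by (simp add: bregman_interior leg x y)
qed

section \<open>Measurability\<close>

lemma closed_fun_borel_measurable:
  fixes g :: "'a::euclidean_space \<Rightarrow> ereal"
  assumes "closed_fun g" and "\<And>x. g x \<noteq> -\<infinity>"
  shows "g \<in> borel_measurable borel"
  unfolding borel_measurable_iff_Iic_ereal
proof
  fix a :: ereal
  show "g -` {..a} \<inter> space borel \<in> sets borel"
  proof (cases a)
    case (real c)
    have "closed ((\<lambda>x::'a. (x, c)) -` {(x, b::real). g x \<le> ereal b})"
      by (rule closed_vimage) (use assms(1) in \<open>auto simp: closed_fun_def intro!: continuous_intros\<close>)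
    moreover have "(\<lambda>x::'a. (x, c)) -` {(x, b::real). g x \<le> ereal b} = g -` {..a} \<inter> space borel"
      using real by auto
    ultimately show ?thesis by (metis borel_closed)
  next
    case PInf
    then have "g -` {..a} \<inter> space borel = UNIV" by auto
    then show ?thesis by simp
  next
    case MInf
    then have "g -` {..a} \<inter> space borel = {}" using assms(2) by auto
    then show ?thesis by simp
  qed
qed

text \<open>
  The gradient is a pointwise limit of difference quotients of a Borel function. Outside its
  effective domain the real part of \<open>\<Phi>\<close> is \<open>0\<close>, which still leaves a Borel function on the whole space,
  so the quotients need no restriction to step lengths that stay in the interior.
\<close>
lemma bregman_borel_measurable:
  fixes \<Phi> :: "'a::euclidean_space \<Rightarrow> ereal"
  assumes leg: "legendre \<Phi>" and y: "y \<in> interior (edom \<Phi>)"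
  shows "(\<lambda>x. bregman \<Phi> y x) \<in> borel_measurable (restrict_space borel (interior (edom \<Phi>)))"
proof -
  let ?\<phi> = "\<lambda>z. real_of_ereal (\<Phi> z)" and ?B = "restrict_space borel (interior (edom \<Phi>))"
  have "\<Phi> \<in> borel_measurable borel"
    using leg unfolding legendre_def by (intro closed_fun_borel_measurable) blast+
  then have \<phi>: "?\<phi> \<in> borel_measurable borel" by simp
  have id: "(\<lambda>x. x) \<in> borel_measurable ?B"
    by (rule measurable_restrict_space1) simp
  note [measurable] = measurable_compose[OF id \<phi>] id \<phi>
  have gr: "(\<lambda>x. egradient \<Phi> x \<bullet> d) \<in> borel_measurable ?B" for d
  proof (rule borel_measurable_LIMSEQ_real)
    fix x assume "x \<in> space ?B"
    then have "((\<lambda>t. (?\<phi> (x + t *\<^sub>R d) - ?\<phi> x) / t) \<longlongrightarrow> egradient \<Phi> x \<bullet> d) (at_right 0)"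
      by (intro directional_derivative_tendsto legendre_differentiable leg) (simp add: space_restrict_space)
    then show "(\<lambda>n. (?\<phi> (x + (1 / real (Suc n)) *\<^sub>R d) - ?\<phi> x) / (1 / real (Suc n))) \<longlonglongrightarrow> egradient \<Phi> x \<bullet> d"
    proof (rule filterlim_compose)
      show "filterlim (\<lambda>n. 1 / real (Suc n)) (at_right 0) sequentially"
        unfolding filterlim_at using LIMSEQ_inverse_real_of_nat
        by (auto simp: inverse_eq_divide)
    qed
  qed measurable
  have "(\<lambda>x. \<Sum>b\<in>Basis. (egradient \<Phi> x \<bullet> b) * ((y - x) \<bullet> b)) \<in> borel_measurable ?B"
    using gr by measurable
  then have "(\<lambda>x. egradient \<Phi> x \<bullet> (y - x)) \<in> borel_measurable ?B"
    by (simp add: euclidean_inner[symmetric])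
  then have "(\<lambda>x. ereal (?\<phi> y - ?\<phi> x - egradient \<Phi> x \<bullet> (y - x))) \<in> borel_measurable ?B"
    by measurable
  then show ?thesis
    by (rule measurable_cong[THEN iffD1, rotated]) (simp add: space_restrict_space bregman_interior leg y)
qed

lemma locally_lipschitz_continuous_on:
  assumes "locally_lipschitz f"
  shows "continuous_on UNIV f"
proof -
  have "isCont f x" for x
  proof -
    obtain e C where e: "e > 0" and "C-lipschitz_on (ball x e) f"
      using assms unfolding locally_lipschitz_def by blast
    then have "continuous_on (ball x e) f" by (intro lipschitz_on_continuous_on)
    with e show ?thesis by (auto simp: continuous_on_eq_continuous_at)
  qed
  then show ?thesis by (simp add: continuous_at_imp_continuous_on)
qed

section \<open>One proximal step\<close>

text \<open>
  Adding \<open>\<mu> \<Phi>\<close> back to the convex function \<open>m + r - \<mu> \<Phi>\<close> preserves convexity because \<open>\<mu> \<ge> 0\<close>.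
\<close>
lemma model_convex_on:
  fixes \<Phi> r :: "'a::euclidean_space \<Rightarrow> ereal"
  assumes leg: "legendre \<Phi>" and r: "\<And>x. r x \<noteq> -\<infinity>" and dom: "convex (edom r)"
    and \<mu>: "\<mu> \<ge> 0"
    and sc: "rel_strongly_convex_on (interior (edom \<Phi>)) \<mu> \<Phi> (\<lambda>y. ereal (m y) + r y)"
  shows "convex_on (interior (edom \<Phi>) \<inter> edom r) (\<lambda>y. m y + real_of_ereal (r y))"
proof (rule convex_onI)
  let ?U = "interior (edom \<Phi>)" and ?\<phi> = "\<lambda>z. real_of_ereal (\<Phi> z)"
  have cvx: "convex ?U"
    using legendre_convex_on[OF leg] by (rule convex_on_imp_convex)
  show cV: "convex (?U \<inter> edom r)"
    using cvx dom by (rule convex_Int)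
  have val: "ereal (m z) + r z - ereal \<mu> * \<Phi> z = ereal (m z + real_of_ereal (r z) - \<mu> * ?\<phi> z)"
    if z: "z \<in> ?U \<inter> edom r" for z
  proof -
    have "r z \<noteq> \<infinity>" using z by (auto simp: edom_def)
    with r[of z] obtain b where "r z = ereal b" by (cases "r z") auto
    moreover obtain a where "\<Phi> z = ereal a"
      using legendre_interior_real[OF leg, of z] z by blast
    ultimately show ?thesis by simp
  qed
  fix t :: real and x y
  assume a: "0 < t" "t < 1" "x \<in> ?U \<inter> edom r" "y \<in> ?U \<inter> edom r"
  let ?z = "(1 - t) *\<^sub>R x + t *\<^sub>R y"
  have z: "?z \<in> ?U \<inter> edom r"
    using cV a(3,4) less_imp_le[OF a(1)] less_imp_le[OF a(2)] by (rule convexD_alt)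
  have "0 \<le> 1 - t" "0 \<le> t" "1 - t + t = 1" using a by auto
  with sc a have "ereal (m ?z) + r ?z - ereal \<mu> * \<Phi> ?z
      \<le> ereal (1 - t) * (ereal (m x) + r x - ereal \<mu> * \<Phi> x) + ereal t * (ereal (m y) + r y - ereal \<mu> * \<Phi> y)"
    unfolding rel_strongly_convex_on_def econvex_on_def by blast
  then have "m ?z + real_of_ereal (r ?z) - \<mu> * ?\<phi> ?z
      \<le> (1 - t) * (m x + real_of_ereal (r x) - \<mu> * ?\<phi> x) + t * (m y + real_of_ereal (r y) - \<mu> * ?\<phi> y)"
    unfolding val[OF z] val[OF a(3)] val[OF a(4)] by simp
  moreover have "\<mu> * ?\<phi> ?z \<le> \<mu> * ((1 - t) * ?\<phi> x + t * ?\<phi> y)"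
    using convex_onD[OF legendre_convex_on[OF leg], of t x y] a by (intro mult_left_mono \<mu>) auto
  ultimately show "m ?z + real_of_ereal (r ?z)
      \<le> (1 - t) * (m x + real_of_ereal (r x)) + t * (m y + real_of_ereal (r y))"
    by (simp add: algebra_simps)
qed

text \<open>
  Here \<open>m\<close> is the model at \<open>x\<close> for one sample. The Lipschitz bound replaces \<open>m q\<close> by \<open>m x\<close> at the cost of
  \<open>L * sqrt (D(q, x))\<close>, which the proximal term \<open>D(q, x) / \<eta>\<close> pays for.
\<close>
lemma model_prox_step:
  fixes \<Phi> r :: "'a::euclidean_space \<Rightarrow> ereal"
  assumes leg: "legendre \<Phi>" and r: "\<And>x. r x \<noteq> -\<infinity>"
    and cvx: "convex_on (interior (edom \<Phi>) \<inter> edom r) (\<lambda>y. m y + real_of_ereal (r y))"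
    and x: "x \<in> interior (edom \<Phi>) \<inter> edom r" and y: "y \<in> interior (edom \<Phi>) \<inter> edom r"
    and \<eta>: "\<eta> > 0"
    and min: "is_arg_min (\<lambda>z. ereal (m z) + r z + ereal (1 / \<eta>) * bregman \<Phi> z x)
                (\<lambda>z. z \<in> interior (edom \<Phi>)) q"
    and lip: "\<And>z. z \<in> interior (edom \<Phi>) \<inter> edom r \<Longrightarrow>
                m x - m z \<le> L * sqrt (real_of_ereal (bregman \<Phi> z x))"
  shows "q \<in> interior (edom \<Phi>) \<inter> edom r"
    and "\<eta> * real_of_ereal (r q) + real_of_ereal (bregman \<Phi> y q) + \<eta> * m x
      \<le> \<eta> * real_of_ereal (r y) + \<eta> * m y + real_of_ereal (bregman \<Phi> y x) + (\<eta> * L)\<^sup>2 / 4"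
proof -
  let ?U = "interior (edom \<Phi>)" and ?D = "\<lambda>y x. real_of_ereal (bregman \<Phi> y x)"
  have breg: "bregman \<Phi> z w = ereal (?D z w)" if "z \<in> ?U" "w \<in> ?U" for z w
    using bregman_interior[OF leg that(2,1)] by simp
  have rval: "r z = ereal (real_of_ereal (r z))" if "z \<in> edom r" for z
    using that r[of z] by (cases "r z") (auto simp: edom_def)
  have val: "ereal (m z) + r z + ereal (1 / \<eta>) * bregman \<Phi> z x
      = ereal (m z + real_of_ereal (r z) + 1 / \<eta> * ?D z x)" if "z \<in> ?U \<inter> edom r" for z
    using breg[of z x] rval[of z] that x by (metis IntD1 IntD2 plus_ereal.simps(1) times_ereal.simps(1))
  have qU: "q \<in> ?U" and le: "\<And>z. z \<in> ?U \<Longrightarrow> ereal (m q) + r q + ereal (1 / \<eta>) * bregman \<Phi> q x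
      \<le> ereal (m z) + r z + ereal (1 / \<eta>) * bregman \<Phi> z x"
    using min by (auto simp: is_arg_min_linorder)
  have "r q \<noteq> \<infinity>"
  proof
    assume "r q = \<infinity>"
    then have "ereal (m q) + r q + ereal (1 / \<eta>) * bregman \<Phi> q x = \<infinity>"
      using breg[OF qU, of x] x by (metis IntD1 PInfty_neq_ereal(1) ereal_plus_eq_PInfty plus_ereal.simps(2) times_ereal.simps(1) ereal_MInfty_eq_plus MInfty_neq_PInfty(1))
    with le[of x] x show False unfolding val[OF x] by simp
  qed
  then show q: "q \<in> ?U \<inter> edom r" using qU by (simp add: edom_def)
  have three: "m q + real_of_ereal (r q) + 1 / \<eta> * ?D q x + 1 / \<eta> * ?D y q
      \<le> m y + real_of_ereal (r y) + 1 / \<eta> * ?D y x"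
  proof (rule bregman_three_points[OF leg _ cvx _ q y])
    fix z assume z: "z \<in> ?U \<inter> edom r"
    with le[of z] show "m q + real_of_ereal (r q) + 1 / \<eta> * ?D q x \<le> m z + real_of_ereal (r z) + 1 / \<eta> * ?D z x"
      unfolding val[OF z] val[OF q] by simp
  qed (use x \<eta> in auto)
  have scaled: "\<eta> * (m q + real_of_ereal (r q)) + ?D q x + ?D y q
      \<le> \<eta> * (m y + real_of_ereal (r y)) + ?D y x"
    using mult_left_mono[OF three, of \<eta>] \<eta> by (simp add: distrib_left)
  have "0 \<le> ?D q x"
    using bregman_nonneg[OF leg _ qU, of x] x by (simp add: real_of_ereal_pos)
  then have sq: "(sqrt (?D q x))\<^sup>2 = ?D q x" by simp
  \<comment> \<open>Completing the square absorbs the error of the model into the proximal term.\<close>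
  have "0 \<le> (sqrt (?D q x) - \<eta> * L / 2)\<^sup>2" by simp
  then have "\<eta> * (L * sqrt (?D q x)) \<le> ?D q x + (\<eta> * L)\<^sup>2 / 4"
    unfolding power2_diff sq by (simp add: power_divide algebra_simps)
  moreover have "\<eta> * (m x - m q) \<le> \<eta> * (L * sqrt (?D q x))"
    using lip[OF q] \<eta> by simp
  ultimately show "\<eta> * real_of_ereal (r q) + ?D y q + \<eta> * m x
      \<le> \<eta> * real_of_ereal (r y) + \<eta> * m y + ?D y x + (\<eta> * L)\<^sup>2 / 4"
    using scaled by (simp add: distrib_left right_diff_distrib)
qed

text \<open>
  For one fixed \<open>x\<close>, the estimate for single samples bounds the integrand almost everywhere by an
  integrable function with integral \<open>K\<close>. Shifting \<open>r\<close> by its lower bound \<open>R\<close> makes both summands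
  nonnegative. The fact \<open>0 \<le> K\<close> allows \<open>ennreal K\<close> to be added to further terms inside the reals.
\<close>
lemma expected_model_prox_step:
  fixes \<Phi> r :: "'a::euclidean_space \<Rightarrow> ereal" and m :: "'a \<Rightarrow> 'o \<Rightarrow> real"
  assumes leg: "legendre \<Phi>" and P: "prob_space P" and R: "\<And>z. ereal R \<le> r z"
    and x: "x \<in> interior (edom \<Phi>) \<inter> edom r" and y: "y \<in> interior (edom \<Phi>) \<inter> edom r"
    and \<eta>: "\<eta> > 0"
    and mx: "integrable P (m x)" and my: "integrable P (m y)" and L2: "integrable P (\<lambda>s. (L s)\<^sup>2)"
    and cvx: "AE s in P. convex_on (interior (edom \<Phi>) \<inter> edom r) (\<lambda>z. m z s + real_of_ereal (r z))"
    and min: "AE s in P. is_arg_min (\<lambda>z. ereal (m z s) + r z + ereal (1 / \<eta>) * bregman \<Phi> z x)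
                (\<lambda>z. z \<in> interior (edom \<Phi>)) (q s)"
    and lip: "\<And>z s. z \<in> interior (edom \<Phi>) \<inter> edom r \<Longrightarrow> s \<in> space P \<Longrightarrow>
                m x s - m z s \<le> L s * sqrt (real_of_ereal (bregman \<Phi> z x))"
    and K: "K = \<eta> * (real_of_ereal (r y) - R) + real_of_ereal (bregman \<Phi> y x)
        + \<eta> * ((\<integral>s. m y s \<partial>P) - (\<integral>s. m x s \<partial>P)) + \<eta>\<^sup>2 * (\<integral>s. (L s)\<^sup>2 \<partial>P) / 4"
  shows "(\<integral>\<^sup>+s. ennreal \<eta> * e2ennreal (r (q s) - ereal R) + e2ennreal (bregman \<Phi> y (q s)) \<partial>P) \<le> ennreal K"
      (is "?I \<le> _")
    and "0 \<le> K"
proof -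
  interpret P: prob_space P by (rule P)
  let ?U = "interior (edom \<Phi>)" and ?D = "\<lambda>y x. real_of_ereal (bregman \<Phi> y x)"
  define H where "H s = \<eta> * (real_of_ereal (r y) - R) + ?D y x + \<eta> * (m y s - m x s) + \<eta>\<^sup>2 * (L s)\<^sup>2 / 4" for s
  have rm: "r z \<noteq> -\<infinity>" for z using R[of z] by auto
  have AE: "AE s in P. ennreal \<eta> * e2ennreal (r (q s) - ereal R) + e2ennreal (bregman \<Phi> y (q s)) \<le> ennreal (H s)
                \<and> 0 \<le> H s"
    using cvx min AE_space
  proof eventually_elim
    case (elim s)
    note step = model_prox_step[OF leg rm elim(1) x y \<eta> elim(2) lip[OF _ elim(3)]]
    have q: "q s \<in> ?U" "q s \<in> edom r" using step(1) by auto
    obtain b where b: "r (q s) = ereal b"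
      using q(2) rm[of "q s"] by (cases "r (q s)") (auto simp: edom_def)
    have "R \<le> b" using R[of "q s"] by (simp add: b)
    obtain d where d: "bregman \<Phi> y (q s) = ereal d"
      using bregman_interior[OF leg q(1), of y] y by blast
    have "0 \<le> d" using bregman_nonneg[OF leg q(1), of y] y by (simp add: d)
    have "\<eta> * (b - R) + d \<le> H s"
      using step(2) by (simp add: H_def b d algebra_simps power_mult_distrib)
    moreover have "0 \<le> \<eta> * (b - R)" using \<open>R \<le> b\<close> \<eta> by simp
    ultimately show ?case
      using \<open>0 \<le> d\<close> \<eta> by (simp add: b d flip: ennreal_mult' ennreal_plus)
  qed
  have int: "integrable P H"
    unfolding H_def using mx my L2 by (auto intro!: Bochner_Integration.integrable_add integrable_mult_right)
  have HK: "(\<integral>s. H s \<partial>P) = K"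
    unfolding H_def K using mx my L2 by (simp add: P.prob_space)
  have "?I \<le> (\<integral>\<^sup>+s. ennreal (H s) \<partial>P)"
    using AE by (intro nn_integral_mono_AE) auto
  also have "\<dots> = ennreal (\<integral>s. H s \<partial>P)"
    using int AE by (intro nn_integral_eq_integral) auto
  finally show "?I \<le> ennreal K" by (simp only: HK)
  have "0 \<le> (\<integral>s. H s \<partial>P)"
    using AE by (intro integral_nonneg_AE) auto
  then show "0 \<le> K" by (simp only: HK)
qed

section \<open>Points of comparison near a minimizer\<close>

text \<open>
  Both estimates come from \<open>F(p x) + D(p x, x) / l \<le> F(xstar) + D(xstar, x) / l\<close>: drop the divergence
  on the left for the first, and use \<open>F(xstar) \<le> F(p x)\<close> for the second. The point \<open>xstar\<close> may lie on the
  boundary of the domain of \<open>\<Phi>\<close>, whereas \<open>p x\<close> is an interior point.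
\<close>
lemma prox_point_estimate:
  fixes \<Phi> F :: "'a::euclidean_space \<Rightarrow> ereal"
  assumes leg: "legendre \<Phi>" and x: "x \<in> interior (edom \<Phi>)" and l: "l > 0"
    and p: "prox_map \<Phi> F l p"
    and star: "F xstar = ereal m" and m: "\<And>z. ereal m \<le> F z"
    and d: "bregman \<Phi> xstar x = ereal d"
  shows "p x \<in> interior (edom \<Phi>)" and "F (p x) \<le> ereal (m + d / l)" and "bregman \<Phi> (p x) x \<le> ereal d"
proof -
  let ?B = "restrict_space borel (interior (edom \<Phi>))"
  have pmin: "unique_minimizer UNIV (\<lambda>y. F y + ereal (1 / l) * bregman \<Phi> y x) (p x)"
    using p[unfolded prox_map_def, THEN conjunct2] x by (rule bspec)
  have "p \<in> ?B \<rightarrow>\<^sub>M ?B"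
    by (rule p[unfolded prox_map_def, THEN conjunct1])
  moreover have "x \<in> space ?B" using x by (simp add: space_restrict_space)
  ultimately have "p x \<in> space ?B" by (rule measurable_space)
  then show px: "p x \<in> interior (edom \<Phi>)" by (simp add: space_restrict_space)
  obtain e where e: "bregman \<Phi> (p x) x = ereal e"
    using bregman_interior[OF leg x px] by blast
  then have e0: "0 \<le> e"
    using bregman_nonneg[OF leg x px] by simp
  have "is_arg_min (\<lambda>y. F y + ereal (1 / l) * bregman \<Phi> y x) (\<lambda>z. z \<in> UNIV) (p x)"
    using pmin by (simp add: unique_minimizer_def)
  then have "F (p x) + ereal (1 / l) * bregman \<Phi> (p x) x \<le> F xstar + ereal (1 / l) * bregman \<Phi> xstar x"
    unfolding is_arg_min_linorder by blast
  then have le: "F (p x) + ereal (e / l) \<le> ereal (m + d / l)"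
    by (simp add: e d star)
  then have "F (p x) \<noteq> \<infinity>" by auto
  then obtain b where b: "F (p x) = ereal b" using m[of "p x"] by (cases "F (p x)") auto
  have "b + e / l \<le> m + d / l" "m \<le> b" using le m[of "p x"] by (simp_all add: b)
  moreover have "0 \<le> e / l" using e0 l by simp
  ultimately have "b \<le> m + d / l" "e / l \<le> d / l" by linarith+
  then show "F (p x) \<le> ereal (m + d / l)" "bregman \<Phi> (p x) x \<le> ereal d"
    using l by (simp_all add: b e divide_le_cancel)
qed

section \<open>Convexity of the objective and averaging\<close>

text \<open>
  To compare \<open>f + g\<close> at a convex combination \<open>z\<close> with its values at the end points, use the model
  centred at \<open>z\<close>: it is exact at \<open>z\<close>, and it underestimates at the end points.
\<close>
lemma convex_on_objective:
  fixes r :: "'a::real_vector \<Rightarrow> ereal" and fm :: "'a \<Rightarrow> 'a \<Rightarrow> 'o \<Rightarrow> real"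
  assumes P: "prob_space P" and V: "convex V"
    and eq: "\<And>x. x \<in> V \<Longrightarrow> (\<integral>s. fm x x s \<partial>P) = f x"
    and le: "\<And>x y. x \<in> V \<Longrightarrow> y \<in> V \<Longrightarrow> integrable P (fm x y) \<and> (\<integral>s. fm x y s \<partial>P) \<le> f y"
    and cvx: "\<And>x. x \<in> V \<Longrightarrow> AE s in P. convex_on V (\<lambda>y. fm x y s + g y)"
  shows "convex_on V (\<lambda>x. f x + g x)"
proof (rule convex_onI)
  fix t :: real and x y
  assume a: "0 < t" "t < 1" "x \<in> V" "y \<in> V"
  interpret P: prob_space P by (rule P)
  let ?z = "(1 - t) *\<^sub>R x + t *\<^sub>R y"
  have z: "?z \<in> V" using convexD_alt[OF V a(3,4), of t] a by simp
  note [simp] = le[OF z z, THEN conjunct1] le[OF z a(3), THEN conjunct1] le[OF z a(4), THEN conjunct1]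
  have "f ?z + g ?z = (\<integral>s. fm ?z ?z s + g ?z \<partial>P)"
    by (simp add: eq[OF z] P.prob_space)
  also have "\<dots> \<le> (\<integral>s. (1 - t) * (fm ?z x s + g x) + t * (fm ?z y s + g y) \<partial>P)"
  proof (rule integral_mono_AE)
    show "AE s in P. fm ?z ?z s + g ?z \<le> (1 - t) * (fm ?z x s + g x) + t * (fm ?z y s + g y)"
      using cvx[OF z]
    proof eventually_elim
      case (elim s)
      from convex_onD[OF elim, of t x y] show ?case using a by simp
    qed
  qed simp_all
  also have "\<dots> = (1 - t) * ((\<integral>s. fm ?z x s \<partial>P) + g x) + t * ((\<integral>s. fm ?z y s \<partial>P) + g y)"
    by (simp add: P.prob_space)
  also have "\<dots> \<le> (1 - t) * (f x + g x) + t * (f y + g y)"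
    using le[OF z a(3)] le[OF z a(4)] a by (intro add_mono mult_left_mono) auto
  finally show "f ?z + g ?z \<le> (1 - t) * (f x + g x) + t * (f y + g y)" .
qed (rule V)

text \<open>
  Points outside \<open>V\<close> are admitted as long as \<open>F\<close> is infinite there, since the right-hand side is then
  \<open>\<infinity>\<close>. So the inequality can be integrated without first showing that the iterates stay in \<open>V\<close>.
\<close>
lemma jensen_extended:
  fixes F :: "'a::real_vector \<Rightarrow> ereal"
  assumes cvx: "convex_on V g" and Fv: "\<And>x. x \<in> V \<Longrightarrow> F x = ereal (g x)"
    and I: "finite I" "I \<noteq> {}" and w: "\<And>i. i \<in> I \<Longrightarrow> w i > 0"
    and x: "\<And>i. i \<in> I \<Longrightarrow> x i \<in> V \<or> F (x i) = \<infinity>" and m: "\<And>i. i \<in> I \<Longrightarrow> ereal m \<le> F (x i)"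
  shows "e2ennreal (F ((1 / sum w I) *\<^sub>R (\<Sum>i\<in>I. w i *\<^sub>R x i)) - ereal m)
       \<le> ennreal (1 / sum w I) * (\<Sum>i\<in>I. ennreal (w i) * e2ennreal (F (x i) - ereal m))"
proof (cases "\<forall>i\<in>I. x i \<in> V")
  have S: "sum w I > 0" using I w by (rule sum_pos)
  case False
  then obtain i where i: "i \<in> I" "F (x i) = \<infinity>" using x by blast
  then have "ennreal (w i) * e2ennreal (F (x i) - ereal m) = top"
    using w[OF i(1)] by (simp add: ennreal_mult_top)
  moreover have "ennreal (w i) * e2ennreal (F (x i) - ereal m) \<le> (\<Sum>i\<in>I. ennreal (w i) * e2ennreal (F (x i) - ereal m))"
    using I(1) i(1) by (intro member_le_sum) auto
  ultimately have "(\<Sum>i\<in>I. ennreal (w i) * e2ennreal (F (x i) - ereal m)) = top"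
    by (simp add: top_unique)
  then show ?thesis using S by (simp add: ennreal_mult_top)
next
  case True
  let ?S = "sum w I"
  have S: "?S > 0" using I w by (rule sum_pos)
  have avg: "(1 / ?S) *\<^sub>R (\<Sum>i\<in>I. w i *\<^sub>R x i) = (\<Sum>i\<in>I. (w i / ?S) *\<^sub>R x i)"
    by (simp add: scaleR_sum_right)
  have w1: "(\<Sum>i\<in>I. w i / ?S) = 1" using S by (simp flip: sum_divide_distrib)
  have w0: "0 \<le> w i / ?S" if "i \<in> I" for i using w[OF that] S by simp
  have avgV: "(\<Sum>i\<in>I. (w i / ?S) *\<^sub>R x i) \<in> V"
    using True by (intro convex_sum I(1) convex_on_imp_convex[OF cvx] w1 w0) auto
  have "g (\<Sum>i\<in>I. (w i / ?S) *\<^sub>R x i) \<le> (\<Sum>i\<in>I. w i / ?S * g (x i))"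
    using True by (intro convex_on_sum[OF I cvx w1 w0]) auto
  also have "\<dots> = (\<Sum>i\<in>I. w i * g (x i)) / ?S"
    by (simp add: sum_divide_distrib)
  finally have "?S * (g (\<Sum>i\<in>I. (w i / ?S) *\<^sub>R x i) - m) \<le> (\<Sum>i\<in>I. w i * g (x i)) - ?S * m"
    using S by (simp add: pos_le_divide_eq algebra_simps)
  also have "\<dots> = (\<Sum>i\<in>I. w i * (g (x i) - m))"
    by (simp add: right_diff_distrib sum_subtractf sum_distrib_right)
  finally have "ennreal (?S * (g (\<Sum>i\<in>I. (w i / ?S) *\<^sub>R x i) - m)) \<le> ennreal (\<Sum>i\<in>I. w i * (g (x i) - m))"
    by (rule ennreal_leI)
  also have "\<dots> = (\<Sum>i\<in>I. ennreal (w i * (g (x i) - m)))"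
  proof (rule sum_ennreal[symmetric])
    fix i assume i: "i \<in> I"
    then have "m \<le> g (x i)" using m[OF i] Fv[of "x i"] True by (metis ereal_less_eq(3))
    then show "0 \<le> w i * (g (x i) - m)" using w[OF i] by simp
  qed
  also have "\<dots> = (\<Sum>i\<in>I. ennreal (w i) * e2ennreal (F (x i) - ereal m))"
  proof (rule sum.cong)
    fix i assume i: "i \<in> I"
    then have "F (x i) - ereal m = ereal (g (x i) - m)"
      using Fv[of "x i"] True by (metis ereal_minus(1))
    then show "ennreal (w i * (g (x i) - m)) = ennreal (w i) * e2ennreal (F (x i) - ereal m)"
      using w[OF i] by (simp add: ennreal_mult')
  qed simp
  finally have *: "ennreal (?S * (g (\<Sum>i\<in>I. (w i / ?S) *\<^sub>R x i) - m))
      \<le> (\<Sum>i\<in>I. ennreal (w i) * e2ennreal (F (x i) - ereal m))" .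
  have inv: "ennreal (1 / ?S) * ennreal ?S = 1"
    using S by (simp flip: ennreal_mult)
  have "e2ennreal (F (\<Sum>i\<in>I. (w i / ?S) *\<^sub>R x i) - ereal m)
      = ennreal (1 / ?S) * ennreal (?S * (g (\<Sum>i\<in>I. (w i / ?S) *\<^sub>R x i) - m))"
    using S by (simp add: Fv[OF avgV] ennreal_mult' mult.assoc[symmetric] inv)
  also have "\<dots> \<le> ennreal (1 / ?S) * (\<Sum>i\<in>I. ennreal (w i) * e2ennreal (F (x i) - ereal m))"
    using * by (rule mult_left_mono) simp
  finally show ?thesis unfolding avg .
qed

section \<open>Random recursions\<close>

text \<open>
  The iterate \<open>X t\<close> is a measurable function of the samples with index below \<open>t\<close>. Hence it is independent of
  the sample \<open>\<xi> t\<close>, and Fubini's theorem allows the latter to be integrated out with the former fixed.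
\<close>
lemma (in prob_space) random_recursion:
  fixes q :: "nat \<Rightarrow> 'b \<Rightarrow> 'o \<Rightarrow> 'b"
  assumes indep: "indep_vars (\<lambda>_. P) \<xi> UNIV"
    and ident: "\<And>t. distr M P (\<xi> t) = P"
    and q: "\<And>t. (\<lambda>(x, s). q t x s) \<in> B \<Otimes>\<^sub>M P \<rightarrow>\<^sub>M B"
    and x0: "x0 \<in> space B"
    and X_0: "\<And>\<omega>. \<omega> \<in> space M \<Longrightarrow> X 0 \<omega> = x0"
    and X_Suc: "\<And>t \<omega>. \<omega> \<in> space M \<Longrightarrow> X (Suc t) \<omega> = q t (X t \<omega>) (\<xi> t \<omega>)"
  shows random_recursion_measurable: "X t \<in> M \<rightarrow>\<^sub>M B"
    and nn_integral_random_recursion: "h \<in> borel_measurable (B \<Otimes>\<^sub>M P) \<Longrightarrow>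
      (\<integral>\<^sup>+\<omega>. h (X t \<omega>, \<xi> t \<omega>) \<partial>M) = (\<integral>\<^sup>+\<omega>. \<integral>\<^sup>+s. h (X t \<omega>, s) \<partial>P \<partial>M)"
proof -
  \<comment> \<open>The iterate after \<open>t\<close> steps as a function of the whole sequence of samples.\<close>
  define path where "path = rec_nat (\<lambda>_. x0) (\<lambda>t p w. q t (p w) (w t))"
  have path: "path 0 w = x0" "path (Suc t) w = q t (path t w) (w t)" for t w
    by (simp_all add: path_def)
  have path_meas: "{..<t} \<subseteq> A \<Longrightarrow> path t \<in> PiM A (\<lambda>_. P) \<rightarrow>\<^sub>M B" for t and A :: "nat set"
  proof (induction t)
    case 0
    then show ?case using x0 by (simp add: path cong: measurable_cong)
  next
    case (Suc t)
    then have "path t \<in> PiM A (\<lambda>_. P) \<rightarrow>\<^sub>M B" by (simp add: lessThan_Suc)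
    moreover have "(\<lambda>w. w t) \<in> PiM A (\<lambda>_. P) \<rightarrow>\<^sub>M P"
      using Suc.prems by (intro measurable_component_singleton) auto
    ultimately have "(\<lambda>w. (path t w, w t)) \<in> PiM A (\<lambda>_. P) \<rightarrow>\<^sub>M B \<Otimes>\<^sub>M P"
      by (rule measurable_Pair)
    from measurable_compose[OF this q[of t]] show ?case
      by (simp add: path cong: measurable_cong)
  qed
  have path_cong: "path t v = path t w" if "\<And>i. i < t \<Longrightarrow> v i = w i" for t v w
    using that by (induction t) (auto simp: path)
  \<comment> \<open>\<open>indep_var\<close> relates random variables with values in the same type. So the present sample is
    represented by a function on the singleton index set \<open>{t}\<close>, of the same type as the past.\<close>
  define past where "past \<omega> = restrict (\<lambda>i. \<xi> i \<omega>) {..<t}" for \<omega>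
  define present where "present \<omega> = restrict (\<lambda>i. \<xi> i \<omega>) {t}" for \<omega>
  have "X n \<omega> = path n (\<lambda>i. \<xi> i \<omega>)" if "\<omega> \<in> space M" for n \<omega>
    using that by (induction n) (auto simp: path X_0 X_Suc)
  then have X_path: "X t \<omega> = path t (past \<omega>)" if "\<omega> \<in> space M" for \<omega>
    using that by (auto simp: past_def intro: path_cong)
  have ind: "indep_var (PiM {..<t} (\<lambda>_. P)) past (PiM {t} (\<lambda>_. P)) present"
    unfolding past_def present_def using indep by (rule indep_var_restrict) auto
  have past: "past \<in> M \<rightarrow>\<^sub>M PiM {..<t} (\<lambda>_. P)" and present: "present \<in> M \<rightarrow>\<^sub>M PiM {t} (\<lambda>_. P)"
    using ind by (auto dest: indep_var_rv1 indep_var_rv2)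
  have pt: "path t \<in> PiM {..<t} (\<lambda>_. P) \<rightarrow>\<^sub>M B"
    by (rule path_meas) simp
  show X: "X t \<in> M \<rightarrow>\<^sub>M B"
    using measurable_compose[OF past pt] X_path by (simp cong: measurable_cong)
  have \<xi>: "\<xi> t \<in> M \<rightarrow>\<^sub>M P"
    using indep by (auto simp: indep_vars_def)
  assume h [measurable]: "h \<in> borel_measurable (B \<Otimes>\<^sub>M P)"
  interpret present: prob_space "distr M (PiM {t} (\<lambda>_. P)) present"
    using present by (rule prob_space_distr)
  have comp: "(\<lambda>v. v t) \<in> PiM {t} (\<lambda>_. P) \<rightarrow>\<^sub>M P"
    by (rule measurable_component_singleton) simp
  note [measurable] = pt comp past present X \<xi>
  interpret P: prob_space P
    using prob_space_distr[OF \<xi>] by (simp add: ident)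
  have "(\<integral>\<^sup>+\<omega>. h (X t \<omega>, \<xi> t \<omega>) \<partial>M) = (\<integral>\<^sup>+\<omega>. (\<lambda>(w, v). h (path t w, v t)) (past \<omega>, present \<omega>) \<partial>M)"
    by (intro nn_integral_cong) (simp add: X_path present_def)
  also have "\<dots> = (\<integral>\<^sup>+z. (\<lambda>(w, v). h (path t w, v t)) z
      \<partial>distr M (PiM {..<t} (\<lambda>_. P) \<Otimes>\<^sub>M PiM {t} (\<lambda>_. P)) (\<lambda>\<omega>. (past \<omega>, present \<omega>)))"
    by (subst nn_integral_distr) simp_all
  also have "\<dots> = (\<integral>\<^sup>+z. (\<lambda>(w, v). h (path t w, v t)) z
      \<partial>(distr M (PiM {..<t} (\<lambda>_. P)) past \<Otimes>\<^sub>M distr M (PiM {t} (\<lambda>_. P)) present))"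
    using ind by (simp add: indep_var_distribution_eq)
  also have "\<dots> = (\<integral>\<^sup>+w. \<integral>\<^sup>+v. h (path t w, v t) \<partial>distr M (PiM {t} (\<lambda>_. P)) present
      \<partial>distr M (PiM {..<t} (\<lambda>_. P)) past)"
    by (subst present.nn_integral_fst[symmetric]) simp_all
  also have "\<dots> = (\<integral>\<^sup>+w. \<integral>\<^sup>+s. h (path t w, s) \<partial>P \<partial>distr M (PiM {..<t} (\<lambda>_. P)) past)"
  proof (rule nn_integral_cong)
    fix w assume "w \<in> space (distr M (PiM {..<t} (\<lambda>_. P)) past)"
    then have w: "w \<in> space (PiM {..<t} (\<lambda>_. P))" by simp
    then have [measurable]: "(\<lambda>s. h (path t w, s)) \<in> borel_measurable P"
      using measurable_space[OF pt] by measurable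
    have "(\<integral>\<^sup>+v. h (path t w, v t) \<partial>distr M (PiM {t} (\<lambda>_. P)) present)
        = (\<integral>\<^sup>+\<omega>. h (path t w, \<xi> t \<omega>) \<partial>M)"
      by (subst nn_integral_distr) (simp_all add: present_def)
    also have "\<dots> = (\<integral>\<^sup>+s. h (path t w, s) \<partial>distr M P (\<xi> t))"
      by (subst nn_integral_distr) simp_all
    finally show "(\<integral>\<^sup>+v. h (path t w, v t) \<partial>distr M (PiM {t} (\<lambda>_. P)) present)
        = (\<integral>\<^sup>+s. h (path t w, s) \<partial>P)"
      by (simp add: ident)
  qed
  also have "\<dots> = (\<integral>\<^sup>+\<omega>. \<integral>\<^sup>+s. h (path t (past \<omega>), s) \<partial>P \<partial>M)"
    by (subst nn_integral_distr) simp_all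
  also have "\<dots> = (\<integral>\<^sup>+\<omega>. \<integral>\<^sup>+s. h (X t \<omega>, s) \<partial>P \<partial>M)"
    by (intro nn_integral_cong) (simp add: X_path)
  finally show "(\<integral>\<^sup>+\<omega>. h (X t \<omega>, \<xi> t \<omega>) \<partial>M) = (\<integral>\<^sup>+\<omega>. \<integral>\<^sup>+s. h (X t \<omega>, s) \<partial>P \<partial>M)" .
qed

text \<open>
  \<open>V\<close> is a Lyapunov function that may change with time: one step of the recursion decreases its mean by the
  mean of \<open>G\<close>, up to the error \<open>c\<close>, and the passage from \<open>V t\<close> to \<open>V (Suc t)\<close> does not increase it. In
  \<^typ>\<open>ennreal\<close> the telescoping is carried out by induction, keeping the last Lyapunov term on the left, so
  that nothing has to be subtracted.
\<close>
lemma (in prob_space) sum_expectation_le_lyapunov: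
  fixes q :: "nat \<Rightarrow> 'b \<Rightarrow> 'o \<Rightarrow> 'b" and V G :: "nat \<Rightarrow> 'b \<Rightarrow> ennreal" and c :: "nat \<Rightarrow> ennreal"
  assumes indep: "indep_vars (\<lambda>_. P) \<xi> UNIV"
    and P: "prob_space P" and ident: "\<And>t. distr M P (\<xi> t) = P"
    and q: "\<And>t. (\<lambda>(x, s). q t x s) \<in> B \<Otimes>\<^sub>M P \<rightarrow>\<^sub>M B"
    and x0: "x0 \<in> space B"
    and X_0: "\<And>\<omega>. \<omega> \<in> space M \<Longrightarrow> X 0 \<omega> = x0"
    and X_Suc: "\<And>t \<omega>. \<omega> \<in> space M \<Longrightarrow> X (Suc t) \<omega> = q t (X t \<omega>) (\<xi> t \<omega>)"
    and V: "\<And>t. V t \<in> borel_measurable B" and G: "\<And>t. G t \<in> borel_measurable B"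
    and step: "\<And>t x. x \<in> space B \<Longrightarrow> (\<integral>\<^sup>+s. V t (q t x s) \<partial>P) + G t x \<le> V t x + c t"
    and dec: "\<And>t x. x \<in> space B \<Longrightarrow> V (Suc t) x \<le> V t x"
  shows "(\<Sum>t=0..n. \<integral>\<^sup>+\<omega>. G t (X t \<omega>) \<partial>M) \<le> V 0 x0 + (\<Sum>t=0..n. c t)"
proof -
  interpret P: prob_space P by (rule P)
  note recursion = indep ident q x0 X_0 X_Suc
  have X: "X t \<in> M \<rightarrow>\<^sub>M B" for t
    using recursion by (rule random_recursion_measurable)
  note [measurable] = measurable_compose[OF X V] measurable_compose[OF X G]
  have one: "(\<integral>\<^sup>+\<omega>. V t (X (Suc t) \<omega>) \<partial>M) + (\<integral>\<^sup>+\<omega>. G t (X t \<omega>) \<partial>M)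
      \<le> (\<integral>\<^sup>+\<omega>. V t (X t \<omega>) \<partial>M) + c t" for t
  proof -
    have h: "(\<lambda>z. V t (q t (fst z) (snd z))) \<in> borel_measurable (B \<Otimes>\<^sub>M P)"
      using measurable_compose[OF q V] by (simp add: case_prod_beta)
    have h': "(\<lambda>\<omega>. \<integral>\<^sup>+s. V t (q t (X t \<omega>) s) \<partial>P) \<in> borel_measurable M"
      using measurable_compose[OF X P.borel_measurable_nn_integral_fst[OF h]] by simp
    have "(\<integral>\<^sup>+\<omega>. V t (X (Suc t) \<omega>) \<partial>M) = (\<integral>\<^sup>+\<omega>. V t (q t (X t \<omega>) (\<xi> t \<omega>)) \<partial>M)"
      by (intro nn_integral_cong) (simp add: X_Suc)
    also have "\<dots> = (\<integral>\<^sup>+\<omega>. \<integral>\<^sup>+s. V t (q t (X t \<omega>) s) \<partial>P \<partial>M)"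
      using nn_integral_random_recursion[OF recursion h, where t = t] by simp
    finally have "(\<integral>\<^sup>+\<omega>. V t (X (Suc t) \<omega>) \<partial>M) + (\<integral>\<^sup>+\<omega>. G t (X t \<omega>) \<partial>M)
        = (\<integral>\<^sup>+\<omega>. (\<integral>\<^sup>+s. V t (q t (X t \<omega>) s) \<partial>P) + G t (X t \<omega>) \<partial>M)"
      using h' by (simp add: nn_integral_add)
    also have "\<dots> \<le> (\<integral>\<^sup>+\<omega>. V t (X t \<omega>) + c t \<partial>M)"
      by (intro nn_integral_mono step) (use measurable_space[OF X] in auto)
    also have "\<dots> = (\<integral>\<^sup>+\<omega>. V t (X t \<omega>) \<partial>M) + c t"
      by (simp add: nn_integral_add emeasure_space_1)
    finally show ?thesis .
  qed
  have "(\<integral>\<^sup>+\<omega>. V n (X (Suc n) \<omega>) \<partial>M) + (\<Sum>t=0..n. \<integral>\<^sup>+\<omega>. G t (X t \<omega>) \<partial>M)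
      \<le> V 0 x0 + (\<Sum>t=0..n. c t)"
  proof (induction n)
    case 0
    have "(\<integral>\<^sup>+\<omega>. V 0 (X 0 \<omega>) \<partial>M) = V 0 x0"
      by (simp add: X_0 emeasure_space_1 cong: nn_integral_cong)
    with one[of 0] show ?case by simp
  next
    case (Suc n)
    let ?V' = "\<integral>\<^sup>+\<omega>. V (Suc n) (X (Suc (Suc n)) \<omega>) \<partial>M" and ?V = "\<integral>\<^sup>+\<omega>. V n (X (Suc n) \<omega>) \<partial>M"
      and ?G = "\<integral>\<^sup>+\<omega>. G (Suc n) (X (Suc n) \<omega>) \<partial>M"
      and ?S = "\<Sum>t=0..n. \<integral>\<^sup>+\<omega>. G t (X t \<omega>) \<partial>M" and ?C = "\<Sum>t=0..n. c t"
    have "(\<integral>\<^sup>+\<omega>. V (Suc n) (X (Suc n) \<omega>) \<partial>M) \<le> (\<integral>\<^sup>+\<omega>. V n (X (Suc n) \<omega>) \<partial>M)"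
      by (intro nn_integral_mono dec) (use measurable_space[OF X] in auto)
    with one[of "Suc n"]
    have step_Suc: "?V' + ?G \<le> ?V + c (Suc n)"
      by (meson add_right_mono order_trans)
    have "?V' + (?S + ?G) = (?V' + ?G) + ?S" by (simp only: ac_simps)
    also have "\<dots> \<le> (?V + c (Suc n)) + ?S" using step_Suc by (rule add_right_mono)
    also have "\<dots> = (?V + ?S) + c (Suc n)" by (simp only: ac_simps)
    also have "\<dots> \<le> (V 0 x0 + ?C) + c (Suc n)" using Suc.IH by (rule add_right_mono)
    also have "\<dots> = V 0 x0 + (?C + c (Suc n))" by (simp only: ac_simps)
    finally show ?case by simp
  qed
  then show ?thesis
    by (rule order_trans[rotated]) simp
qed

section \<open>Convergence in expectation\<close>

theorem theorem7p2:
  fixes \<Phi> r F :: "'a::euclidean_space \<Rightarrow> ereal"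
    and f :: "'a \<Rightarrow> real"
    and U :: "'a set"
    and P :: "'o measure"
    and fm :: "'a \<Rightarrow> 'a \<Rightarrow> 'o \<Rightarrow> real"
    and \<mu> Lc :: real
    and L :: "'o \<Rightarrow> real"
    and S :: "real \<Rightarrow> 'a \<Rightarrow> 'o \<Rightarrow> 'a"
    and \<eta> :: "nat \<Rightarrow> real"
    and M :: "'w measure"
    and \<xi> :: "nat \<Rightarrow> 'w \<Rightarrow> 'o"
    and X :: "nat \<Rightarrow> 'w \<Rightarrow> 'a"
    and x0 xstar :: 'a
    and T :: nat
  assumes legendre: "legendre \<Phi>"
    and U: "U = interior (edom \<Phi>)"
    \<comment> \<open>the problem\<close>
    and F: "F = (\<lambda>x. ereal (f x) + r x)"
    and f: "locally_lipschitz f"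
    and r_proper: "\<And>x. r x \<noteq> -\<infinity>"
    and r_closed: "closed_fun r"
    and r_dom: "convex (edom r)"
    and r_ri: "rel_interior (edom r) \<subseteq> U"
    and r_subdiff: "\<And>x. x \<notin> U \<Longrightarrow> limiting_subdiff (\<lambda>z. r z + \<Phi> z) x = {}"
    \<comment> \<open>(C1)\<close>
    and P: "prob_space P"
    and M: "prob_space M"
    and indep: "prob_space.indep_vars M (\<lambda>_. P) \<xi> UNIV"
    and ident: "\<And>t. distr M P (\<xi> t) = P"
    \<comment> \<open>(C2)\<close>
    and C2_meas: "(\<lambda>(x, y, s). fm x y s) \<in> borel_measurable
        (restrict_space borel U \<Otimes>\<^sub>M (restrict_space borel U \<Otimes>\<^sub>M P))"
    and C2_eq: "\<And>x. x \<in> U \<inter> edom r \<Longrightarrow>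
        integrable P (\<lambda>s. fm x x s) \<and> (\<integral>s. fm x x s \<partial>P) = f x"
    and C2_le: "\<And>x y. x \<in> U \<inter> edom r \<Longrightarrow> y \<in> U \<inter> edom r \<Longrightarrow>
        integrable P (\<lambda>s. fm x y s) \<and> (\<integral>s. fm x y s \<partial>P) \<le> f y"
    \<comment> \<open>(C3)\<close>
    and C3_mu: "\<mu> \<ge> 0"
    and C3: "\<And>x. x \<in> U \<inter> edom r \<Longrightarrow>
        AE s in P. rel_strongly_convex_on U \<mu> \<Phi> (\<lambda>y. ereal (fm x y s) + r y)"
    \<comment> \<open>(C4)\<close>
    and C4_Lc: "Lc > 0"
    and C4_meas: "L \<in> borel_measurable P"
    and C4_nonneg: "\<And>s. s \<in> space P \<Longrightarrow> L s \<ge> 0"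
    and C4_sq: "integrable P (\<lambda>s. (L s)\<^sup>2)"
    and C4_bound: "sqrt (\<integral>s. (L s)\<^sup>2 \<partial>P) \<le> Lc"
    and C4: "\<And>x y s. x \<in> U \<inter> edom r \<Longrightarrow> y \<in> U \<inter> edom r \<Longrightarrow> s \<in> space P \<Longrightarrow>
        fm x x s - fm x y s \<le> L s * sqrt (real_of_ereal (bregman \<Phi> y x))"
    \<comment> \<open>(C5)\<close>
    and C5_F: "\<And>l. l > 0 \<Longrightarrow> \<exists>p. prox_map \<Phi> F l p"
    and C5_model: "\<And>l. l > 0 \<Longrightarrow> model_prox_map P \<Phi> r fm l (S l)"
    \<comment> \<open>the algorithm\<close>
    and steps_pos: "\<And>t. \<eta> t > 0"
    and steps_decseq: "decseq \<eta>"
    and x0: "x0 \<in> U \<inter> edom r"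
    and X_0: "\<And>\<omega>. \<omega> \<in> space M \<Longrightarrow> X 0 \<omega> = x0"
    and X_Suc: "\<And>t \<omega>. \<omega> \<in> space M \<Longrightarrow> X (Suc t) \<omega> = S (\<eta> t) (X t \<omega>) (\<xi> t \<omega>)"
    and xstar: "is_arg_min F (\<lambda>_. True) xstar"
    and T: "T > 0"
  shows "enn2ereal (\<integral>\<^sup>+ \<omega>. e2ennreal
           (F ((1 / (\<Sum>t=0..T. \<eta> t)) *\<^sub>R (\<Sum>t=0..T. \<eta> t *\<^sub>R X t \<omega>)) - F xstar) \<partial>M)
       \<le> (bregman \<Phi> xstar x0 + ereal (\<Sum>t=0..T. (\<eta> t * Lc)\<^sup>2 / 4)
            + ereal (\<eta> 0) * (r x0 - (INF x. r x))) / ereal (\<Sum>t=0..T. \<eta> t)"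
proof -
  interpret M: prob_space M by (rule M)
  interpret P: prob_space P by (rule P)
  let ?V = "U \<inter> edom r" and ?B = "restrict_space borel U" and ?\<Sigma> = "\<Sum>t=0..T. \<eta> t"
    and ?r = "\<lambda>x. real_of_ereal (r x)" and ?D = "\<lambda>y x. real_of_ereal (bregman \<Phi> y x)"
  have \<Sigma>: "?\<Sigma> > 0" using steps_pos by (intro sum_pos) auto
  have rval: "r z = ereal (?r z)" if "z \<in> edom r" for z
    using that r_proper[of z] by (cases "r z") (auto simp: edom_def)
  have Fval: "F z = ereal (f z + ?r z)" if "z \<in> edom r" for z
    unfolding F by (subst rval[OF that]) simp
  have r_infty: "r z = \<infinity>" if "z \<notin> edom r" for z
    using that by (simp add: edom_def)
  have x0U: "x0 \<in> U" and x0r: "x0 \<in> edom r" using x0 by auto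
  have Fmin: "F xstar \<le> F z" for z
    using xstar by (simp add: is_arg_min_linorder)
  obtain m where m: "F xstar = ereal m"
    using Fmin[of x0] Fval[OF x0r] r_proper[of xstar] by (cases "r xstar") (auto simp: F)
  have U_convex: "convex U"
    unfolding U using legendre_edom_convex[OF legendre] by (rule convex_interior)
  then have V_convex: "convex ?V" using r_dom by (rule convex_Int)
  have breg: "bregman \<Phi> z w = ereal (?D z w)" "0 \<le> ?D z w" if "z \<in> U" "w \<in> U" for z w
    using bregman_interior[OF legendre, of w z] bregman_nonneg[OF legendre, of w z] that
    by (simp_all add: U real_of_ereal_pos)
  have ebreg: "e2ennreal (bregman \<Phi> z w) = ennreal (?D z w)" if "z \<in> U" "w \<in> U" for z w
    using breg(1)[OF that] by (metis e2ennreal_ereal)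
  have model_convex: "AE s in P. convex_on ?V (\<lambda>z. fm x z s + ?r z)" if "x \<in> ?V" for x
    using C3[OF that]
  proof eventually_elim
    case (elim s)
    then show ?case
      unfolding U by (rule model_convex_on[OF legendre r_proper r_dom C3_mu])
  qed
  have F_convex: "convex_on ?V (\<lambda>z. f z + ?r z)"
  proof (rule convex_on_objective[where fm = fm, OF P V_convex])
    show "(\<integral>s. fm x x s \<partial>P) = f x" if "x \<in> ?V" for x using C2_eq[OF that] by simp
    show "integrable P (fm x y) \<and> (\<integral>s. fm x y s \<partial>P) \<le> f y" if "x \<in> ?V" "y \<in> ?V" for x y
      using C2_le[OF that] by simp
    show "AE s in P. convex_on ?V (\<lambda>z. fm x z s + ?r z)" if "x \<in> ?V" for x
      using that by (rule model_convex)
  qed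
  have r_meas: "r \<in> borel_measurable ?B"
    using r_closed r_proper
    by (intro measurable_restrict_space1 closed_fun_borel_measurable)
  have "f \<in> borel_measurable borel"
    using locally_lipschitz_continuous_on[OF f] by (rule borel_measurable_continuous_onI)
  then have f_meas: "f \<in> borel_measurable ?B" by (rule measurable_restrict_space1)
  have F_meas: "F \<in> borel_measurable ?B"
    unfolding F using r_meas f_meas by measurable
  have S_meas: "(\<lambda>(x, s). S l x s) \<in> ?B \<Otimes>\<^sub>M P \<rightarrow>\<^sub>M ?B" if "l > 0" for l
    using C5_model[OF that] unfolding U model_prox_map_def by (rule conjunct1)
  have S_min: "AE s in P. is_arg_min (\<lambda>z. ereal (fm x z s) + r z + ereal (1 / l) * bregman \<Phi> z x)
      (\<lambda>z. z \<in> U) (S l x s)" if "l > 0" "x \<in> U" for l x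
  proof -
    have "AE s in P. unique_minimizer U
        (\<lambda>z. ereal (fm x z s) + r z + ereal (1 / l) * bregman \<Phi> z x) (S l x s)"
      using C5_model[OF that(1), unfolded model_prox_map_def, THEN conjunct2] that(2)
      unfolding U by (rule bspec)
    then show ?thesis by eventually_elim (simp add: unique_minimizer_def)
  qed
  let ?avg = "\<lambda>\<omega>. (1 / ?\<Sigma>) *\<^sub>R (\<Sum>t=0..T. \<eta> t *\<^sub>R X t \<omega>)"
  define gap where "gap = (\<integral>\<^sup>+\<omega>. e2ennreal (F (?avg \<omega>) - ereal m) \<partial>M)"

  have X_meas: "X t \<in> M \<rightarrow>\<^sub>M ?B" for t
    by (rule M.random_recursion_measurable[OF indep ident S_meas[OF steps_pos] _ X_0 X_Suc])
      (simp_all add: x0U space_restrict_space)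
  have X_U: "X t \<omega> \<in> U" if "\<omega> \<in> space M" for t \<omega>
    using measurable_space[OF X_meas that, of t] by (simp add: space_restrict_space)

  have gap_le: "gap \<le> ennreal (1 / ?\<Sigma>) * (\<Sum>t=0..T. \<integral>\<^sup>+\<omega>. ennreal (\<eta> t) * e2ennreal (F (X t \<omega>) - ereal m) \<partial>M)"
  proof -
    have [measurable]: "(\<lambda>\<omega>. F (X t \<omega>)) \<in> borel_measurable M" for t
      using X_meas F_meas by (rule measurable_compose)
    have "gap \<le> (\<integral>\<^sup>+\<omega>. ennreal (1 / ?\<Sigma>) * (\<Sum>t=0..T. ennreal (\<eta> t) * e2ennreal (F (X t \<omega>) - ereal m)) \<partial>M)"
      unfolding gap_def
    proof (rule nn_integral_mono)
      fix \<omega> assume \<omega>: "\<omega> \<in> space M"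
      show "e2ennreal (F (?avg \<omega>) - ereal m)
          \<le> ennreal (1 / ?\<Sigma>) * (\<Sum>t=0..T. ennreal (\<eta> t) * e2ennreal (F (X t \<omega>) - ereal m))"
      proof (rule jensen_extended[OF F_convex])
        show "X t \<omega> \<in> ?V \<or> F (X t \<omega>) = \<infinity>" for t
          using X_U[OF \<omega>, of t] r_infty[of "X t \<omega>"] by (auto simp: F)
        show "ereal m \<le> F (X t \<omega>)" for t using Fmin[of "X t \<omega>"] by (simp add: m)
      qed (use Fval steps_pos in auto)
    qed
    also have "\<dots> = ennreal (1 / ?\<Sigma>) * (\<Sum>t=0..T. \<integral>\<^sup>+\<omega>. ennreal (\<eta> t) * e2ennreal (F (X t \<omega>) - ereal m) \<partial>M)"
      by (simp add: nn_integral_cmult nn_integral_sum)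
    finally show ?thesis .
  qed

  \<comment> \<open>The telescoped estimate against a feasible point \<open>y\<close> of \<open>U\<close>. The gap is measured from the minimum \<open>m\<close>
    and not from \<open>F y\<close>, which keeps it nonnegative; the difference goes into the error term.\<close>
  have bound: "(\<Sum>t=0..T. \<integral>\<^sup>+\<omega>. ennreal (\<eta> t) * e2ennreal (F (X t \<omega>) - ereal m) \<partial>M)
      \<le> ennreal (\<eta> 0 * (?r x0 - R) + ?D y x0)
        + (\<Sum>t=0..T. ennreal (\<eta> t * (f y + ?r y - m) + (\<eta> t * Lc)\<^sup>2 / 4))"
    if R: "\<And>z. ereal R \<le> r z" and y: "y \<in> ?V" for R y
  proof -
    let ?W = "\<lambda>t x. ennreal (\<eta> t) * e2ennreal (r x - ereal R) + e2ennreal (bregman \<Phi> y x)"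
    have yU: "y \<in> U" using y by simp
    have R': "R \<le> ?r z" if "z \<in> edom r" for z using R[of z] rval[OF that] by (metis ereal_less_eq(3))
    have Fy: "m \<le> f z + ?r z" if "z \<in> edom r" for z using Fmin[of z] Fval[OF that] by (simp add: m)
    have er: "e2ennreal (r z - ereal R) = ennreal (?r z - R)" if "z \<in> edom r" for z
      using rval[OF that] by (metis e2ennreal_ereal ereal_minus(1))
    have "(\<Sum>t=0..T. \<integral>\<^sup>+\<omega>. ennreal (\<eta> t) * e2ennreal (F (X t \<omega>) - ereal m) \<partial>M)
      \<le> ?W 0 x0 + (\<Sum>t=0..T. ennreal (\<eta> t * (f y + ?r y - m) + (\<eta> t * Lc)\<^sup>2 / 4))"
    proof (rule M.sum_expectation_le_lyapunov[OF indep P ident S_meas[OF steps_pos] _ X_0 X_Suc])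
      show "x0 \<in> space ?B" by (simp add: x0U space_restrict_space)
      have [measurable]: "(\<lambda>x. bregman \<Phi> y x) \<in> borel_measurable ?B"
        unfolding U by (rule bregman_borel_measurable[OF legendre]) (use yU U in simp)
      note [measurable] = r_meas F_meas
      show "?W t \<in> borel_measurable ?B" for t by measurable
      show "(\<lambda>x. ennreal (\<eta> t) * e2ennreal (F x - ereal m)) \<in> borel_measurable ?B" for t by measurable
      show "?W (Suc t) x \<le> ?W t x" for t x
        using decseq_SucD[OF steps_decseq, of t] by (intro add_right_mono mult_right_mono ennreal_leI) auto
      fix t x assume "x \<in> space ?B"
      then have xU: "x \<in> U" by (simp add: space_restrict_space)
      have \<eta>: "\<eta> t > 0" by (rule steps_pos)
      show "(\<integral>\<^sup>+s. ?W t (S (\<eta> t) x s) \<partial>P) + ennreal (\<eta> t) * e2ennreal (F x - ereal m)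
          \<le> ?W t x + ennreal (\<eta> t * (f y + ?r y - m) + (\<eta> t * Lc)\<^sup>2 / 4)"
      proof (cases "x \<in> edom r")
        case False
        \<comment> \<open>At an infeasible point \<open>r x - R\<close> is infinite, and \<open>\<eta> t > 0\<close>.\<close>
        then have "?W t x + ennreal (\<eta> t * (f y + ?r y - m) + (\<eta> t * Lc)\<^sup>2 / 4) = top"
          using \<eta> by (simp add: r_infty ennreal_mult_top)
        then show ?thesis by (simp only: top_greatest)
      next
        case True
        with xU have x: "x \<in> ?V" by simp
        define K where "K = \<eta> t * (?r y - R) + ?D y x
          + \<eta> t * ((\<integral>s. fm x y s \<partial>P) - (\<integral>s. fm x x s \<partial>P)) + (\<eta> t)\<^sup>2 * (\<integral>s. (L s)\<^sup>2 \<partial>P) / 4"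
        note facts = legendre P R x[unfolded U] y[unfolded U] \<eta> C2_eq[OF x, THEN conjunct1]
          C2_le[OF x y, THEN conjunct1] C4_sq model_convex[OF x, unfolded U] S_min[OF \<eta> xU, unfolded U]
          C4[OF x, unfolded U] K_def
        note step = expected_model_prox_step[where m = "fm x" and q = "S (\<eta> t) x" and x = x and y = y, OF facts]
        have g: "0 \<le> \<eta> t * (f x + ?r x - m)" using Fy[OF True] \<eta> by simp
        have "ennreal (\<eta> t) * e2ennreal (F x - ereal m) = ennreal (\<eta> t * (f x + ?r x - m))"
          using \<eta> Fy[OF True] by (simp add: Fval[OF True] ennreal_mult)
        then have "(\<integral>\<^sup>+s. ?W t (S (\<eta> t) x s) \<partial>P) + ennreal (\<eta> t) * e2ennreal (F x - ereal m)
            \<le> ennreal (K + \<eta> t * (f x + ?r x - m))"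
          using step g by (simp add: add_right_mono)
        also have "\<dots> \<le> ennreal (\<eta> t * (?r x - R) + ?D y x + (\<eta> t * (f y + ?r y - m) + (\<eta> t * Lc)\<^sup>2 / 4))"
        proof (rule ennreal_leI)
          have "\<eta> t * (\<integral>s. fm x y s \<partial>P) \<le> \<eta> t * f y"
            using C2_le[OF x y] \<eta> by simp
          moreover have "(\<eta> t)\<^sup>2 * (\<integral>s. (L s)\<^sup>2 \<partial>P) \<le> (\<eta> t)\<^sup>2 * Lc\<^sup>2"
            using sqrt_le_D[OF C4_bound] by (intro mult_left_mono) auto
          ultimately show "K + \<eta> t * (f x + ?r x - m)
              \<le> \<eta> t * (?r x - R) + ?D y x + (\<eta> t * (f y + ?r y - m) + (\<eta> t * Lc)\<^sup>2 / 4)"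
            unfolding K_def C2_eq[OF x, THEN conjunct2]
            by (simp add: power_mult_distrib distrib_left right_diff_distrib)
        qed
        also have "\<dots> = ?W t x + ennreal (\<eta> t * (f y + ?r y - m) + (\<eta> t * Lc)\<^sup>2 / 4)"
        proof -
          have "?W t x = ennreal (\<eta> t * (?r x - R) + ?D y x)"
            using \<eta> R'[OF True] breg(2)[OF yU xU] by (simp add: er[OF True] ebreg[OF yU xU] ennreal_mult)
          moreover have "0 \<le> \<eta> t * (f y + ?r y - m)" using Fy[of y] y \<eta> by simp
          ultimately show ?thesis
            using \<eta> R'[OF True] breg(2)[OF yU xU] by (simp flip: ennreal_plus)
        qed
        finally show ?thesis .
      qed
    qed
    also have "?W 0 x0 = ennreal (\<eta> 0 * (?r x0 - R) + ?D y x0)"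
      using steps_pos[of 0] R'[OF x0r] breg(2)[OF yU x0U]
      by (simp add: er[OF x0r] ebreg[OF yU x0U] ennreal_mult)
    finally show ?thesis .
  qed

  have breg_star: "bregman \<Phi> xstar x0 \<noteq> -\<infinity>"
  proof -
    have "\<Phi> xstar \<noteq> -\<infinity>" using legendre unfolding legendre_def by (elim conjE allE)
    moreover obtain a where "\<Phi> x0 = ereal a"
      using legendre_interior_real[OF legendre, of x0] x0U by (auto simp: U)
    ultimately show ?thesis unfolding bregman_def by (cases "\<Phi> xstar") auto
  qed
  have inf_le: "(INF x. r x) \<le> r x0" by (rule INF_lower) simp
  show ?thesis
  proof (cases "(INF x. r x) = -\<infinity> \<or> bregman \<Phi> xstar x0 = \<infinity>")
    case True
    \<comment> \<open>The right-hand side of the claim is infinite.\<close>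
    then have rhs: "bregman \<Phi> xstar x0 + ereal (\<Sum>t=0..T. (\<eta> t * Lc)\<^sup>2 / 4)
            + ereal (\<eta> 0) * (r x0 - (INF x. r x)) = \<infinity>"
      using breg_star inf_le steps_pos[of 0] rval[OF x0r]
      by (cases "bregman \<Phi> xstar x0"; cases "INF x. r x"; cases "r x0") auto
    show ?thesis unfolding rhs using \<Sigma> by simp
  next
    case False
    obtain R where R: "(INF x. r x) = ereal R"
      using False inf_le rval[OF x0r] by (cases "INF x. r x"; cases "r x0") auto
    obtain d where d: "bregman \<Phi> xstar x0 = ereal d"
      using False breg_star by (cases "bregman \<Phi> xstar x0") auto
    have R_le: "ereal R \<le> r z" for z
      unfolding R[symmetric] by (rule INF_lower) simp
    have R_x0: "R \<le> ?r x0" using R_le[of x0] rval[OF x0r] by (metis ereal_less_eq(3))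
    define K where "K = d + (\<Sum>t=0..T. (\<eta> t * Lc)\<^sup>2 / 4) + \<eta> 0 * (?r x0 - R)"
    have approx: "0 \<le> d \<and> gap \<le> ennreal ((K + ?\<Sigma> * e) / ?\<Sigma>)" if e: "e > 0" for e
    proof -
      \<comment> \<open>Any positive \<open>l\<close> with \<open>d / l \<le> e\<close> would do; the absolute value keeps \<open>l\<close> positive before \<open>0 \<le> d\<close> is known.\<close>
      define l where "l = (\<bar>d\<bar> + 1) / e"
      have l: "l > 0" using e by (simp add: l_def)
      have "d / (\<bar>d\<bar> + 1) \<le> 1" by (subst pos_divide_le_eq) auto
      from mult_left_mono[OF this, of e] have dl: "d / l \<le> e"
        using e by (simp add: l_def mult.commute)
      obtain p where "prox_map \<Phi> F l p" using C5_F[OF l] by blast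
      note p = prox_point_estimate[OF legendre x0U[unfolded U] l this m Fmin[unfolded m] d]
      let ?y = "p x0"
      have yU: "?y \<in> U" using p(1) by (simp add: U)
      have "F ?y \<noteq> \<infinity>" using p(2) by auto
      then have yr: "?y \<in> edom r" by (auto simp: F edom_def)
      have Fy: "f ?y + ?r ?y \<le> m + e" "m \<le> f ?y + ?r ?y"
        using p(2) Fmin[of ?y] dl unfolding Fval[OF yr] m by auto
      have Dy: "0 \<le> ?D ?y x0" "?D ?y x0 \<le> d"
        using p(3) breg[OF yU x0U] by (metis, metis ereal_less_eq(3))
      have summand: "0 \<le> \<eta> t * (f ?y + ?r ?y - m) + (\<eta> t * Lc)\<^sup>2 / 4"
          "\<eta> t * (f ?y + ?r ?y - m) + (\<eta> t * Lc)\<^sup>2 / 4 \<le> \<eta> t * e + (\<eta> t * Lc)\<^sup>2 / 4" for t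
        using steps_pos[of t] Fy by simp_all
      have "?y \<in> ?V" using yU yr by simp
      from order_trans[OF gap_le mult_left_mono[OF bound[OF R_le this]]]
      have "gap \<le> ennreal (1 / ?\<Sigma>) * (ennreal (\<eta> 0 * (?r x0 - R) + ?D ?y x0)
          + (\<Sum>t=0..T. ennreal (\<eta> t * (f ?y + ?r ?y - m) + (\<eta> t * Lc)\<^sup>2 / 4)))"
        by simp
      also have "\<dots> = ennreal (1 / ?\<Sigma>) * ennreal (\<eta> 0 * (?r x0 - R) + ?D ?y x0
          + (\<Sum>t=0..T. \<eta> t * (f ?y + ?r ?y - m) + (\<eta> t * Lc)\<^sup>2 / 4))"
        using steps_pos[of 0] R_x0 Dy summand(1) by (simp add: sum_ennreal sum_nonneg del: ennreal_plus flip: ennreal_plus)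
      also have "\<dots> \<le> ennreal (1 / ?\<Sigma>) * ennreal (K + ?\<Sigma> * e)"
      proof (intro mult_left_mono ennreal_leI)
        have "(\<Sum>t=0..T. \<eta> t * (f ?y + ?r ?y - m) + (\<eta> t * Lc)\<^sup>2 / 4)
            \<le> (\<Sum>t=0..T. \<eta> t * e + (\<eta> t * Lc)\<^sup>2 / 4)"
          by (intro sum_mono summand(2))
        also have "\<dots> = ?\<Sigma> * e + (\<Sum>t=0..T. (\<eta> t * Lc)\<^sup>2 / 4)"
          by (simp add: sum.distrib sum_distrib_right)
        finally show "\<eta> 0 * (?r x0 - R) + ?D ?y x0
            + (\<Sum>t=0..T. \<eta> t * (f ?y + ?r ?y - m) + (\<eta> t * Lc)\<^sup>2 / 4) \<le> K + ?\<Sigma> * e"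
          using Dy(2) unfolding K_def by linarith
      qed simp
      also have "\<dots> = ennreal ((K + ?\<Sigma> * e) / ?\<Sigma>)"
        using \<Sigma> by (simp flip: ennreal_mult')
      finally show ?thesis using Dy by auto
    qed
    have "0 \<le> d" using approx[of 1] by simp
    then have K0: "0 \<le> K"
      unfolding K_def using steps_pos[of 0] R_x0 by (intro add_nonneg_nonneg sum_nonneg) auto
    have "gap \<le> ennreal (K / ?\<Sigma>)"
    proof (rule ennreal_le_epsilon)
      fix e :: real assume e: "0 < e"
      have "(K + ?\<Sigma> * e) / ?\<Sigma> = K / ?\<Sigma> + e" using \<Sigma> by (simp add: add_divide_distrib)
      then show "gap \<le> ennreal (K / ?\<Sigma>) + ennreal e"
        using approx[OF e] K0 \<Sigma> e by (simp flip: ennreal_plus)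
    qed
    then have "enn2ereal gap \<le> ereal (K / ?\<Sigma>)"
      using K0 \<Sigma> by (metis divide_nonneg_pos enn2ereal_ennreal less_eq_ennreal.rep_eq)
    also have "\<dots> = (bregman \<Phi> xstar x0 + ereal (\<Sum>t=0..T. (\<eta> t * Lc)\<^sup>2 / 4)
            + ereal (\<eta> 0) * (r x0 - (INF x. r x))) / ereal ?\<Sigma>"
      unfolding d R K_def using \<Sigma> by (subst rval[OF x0r]) simp
    finally show ?thesis unfolding gap_def m .
  qed
qed

end
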